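(* Let $R$ be a commutative ring with identity and let $I$ be an ideal of $R$. Then: (1) Assume that $R$ is a Dedekind domain and that $I=P_{1}^{\alpha_{1}}\cdots P_{n}^{\alpha_{n}}$ is a nonzero ideal of $R$, where $P_{1},\dots,P_{n}$ are the distinct prime ideals and $\alpha_1,\dots,\alpha_n$ the positive integers uniquely determined by $I$. Then $R/I$ is a $PF$-ring if and only if $\alpha_{i}=1$ for all $i\in\{1,\dots,n\}$. (2) $I$ is a primary ideal of $R$ and $R/I$ is a $PF$-ring if and only if $I$ is a prime ideal of $R$.
   Context: All rings are commutative with identity. A ring $R$ is called a $PF$-ring if every principal ideal of $R$ is flat (as an $R$-module). *)

theory Defs
  imports "HOL-Algebra.Algebra"
begin

section \<open>Tensor products of modules\<close>

definition module_hom ::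
    "[('a, 'r) ring_scheme, ('a, 'b, 'm) module_scheme, ('a, 'c, 'n) module_scheme] \<Rightarrow> ('b \<Rightarrow> 'c) set"
  where "module_hom R M N =
    {f \<in> carrier M \<rightarrow> carrier N.
       (\<forall>x \<in> carrier M. \<forall>y \<in> carrier M. f (x \<oplus>\<^bsub>M\<^esub> y) = f x \<oplus>\<^bsub>N\<^esub> f y) \<and>
       (\<forall>a \<in> carrier R. \<forall>x \<in> carrier M. f (a \<odot>\<^bsub>M\<^esub> x) = a \<odot>\<^bsub>N\<^esub> f x)}"

definition tensor_relations ::
    "[('a, 'r) ring_scheme, ('a, 'b, 'm) module_scheme, ('a, 'c, 'n) module_scheme]
      \<Rightarrow> (('b \<times> 'c) \<Rightarrow>\<^sub>0 int) set"
  where "tensor_relations R M N =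
    {frag_of (x \<oplus>\<^bsub>M\<^esub> x', y) - (frag_of (x, y) + frag_of (x', y)) | x x' y.
       x \<in> carrier M \<and> x' \<in> carrier M \<and> y \<in> carrier N} \<union>
    {frag_of (x, y \<oplus>\<^bsub>N\<^esub> y') - (frag_of (x, y) + frag_of (x, y')) | x y y'.
       x \<in> carrier M \<and> y \<in> carrier N \<and> y' \<in> carrier N} \<union>
    {frag_of (a \<odot>\<^bsub>M\<^esub> x, y) - frag_of (x, a \<odot>\<^bsub>N\<^esub> y) | a x y.
       a \<in> carrier R \<and> x \<in> carrier M \<and> y \<in> carrier N}"

definition tensor_kernel ::
    "[('a, 'r) ring_scheme, ('a, 'b, 'm) module_scheme, ('a, 'c, 'n) module_scheme]
      \<Rightarrow> (('b \<times> 'c) \<Rightarrow>\<^sub>0 int) set"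
  where "tensor_kernel R M N =
    generate (free_Abelian_group (carrier M \<times> carrier N)) (tensor_relations R M N)"

text \<open>The underlying abelian group of the tensor product (in multiplicative notation, as all groups
  in HOL-Algebra). The scalar action on it is not needed for flatness, which only concerns
  injectivity of maps.\<close>

definition tensor_product ::
    "[('a, 'r) ring_scheme, ('a, 'b, 'm) module_scheme, ('a, 'c, 'n) module_scheme]
      \<Rightarrow> (('b \<times> 'c) \<Rightarrow>\<^sub>0 int) set monoid"
  where "tensor_product R M N =
    free_Abelian_group (carrier M \<times> carrier N) Mod tensor_kernel R M N"

text \<open>For \<open>f : N \<rightarrow> N'\<close>, the map \<open>M \<otimes> N \<rightarrow> M \<otimes> N'\<close> sending \<open>x \<otimes> y\<close> to \<open>x \<otimes> f y\<close>.\<close>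

definition tensor_lift :: "('c \<Rightarrow> 'd) \<Rightarrow> (('b \<times> 'c) \<Rightarrow>\<^sub>0 int) \<Rightarrow> (('b \<times> 'd) \<Rightarrow>\<^sub>0 int)"
  where "tensor_lift f = frag_extend (\<lambda>(x, y). frag_of (x, f y))"

definition tensor_map ::
    "[('a, 'r) ring_scheme, ('a, 'b, 'm) module_scheme, ('a, 'c, 'n) module_scheme,
      ('a, 'd, 'k) module_scheme, 'c \<Rightarrow> 'd]
      \<Rightarrow> (('b \<times> 'c) \<Rightarrow>\<^sub>0 int) set \<Rightarrow> (('b \<times> 'd) \<Rightarrow>\<^sub>0 int) set"
  where "tensor_map R M N N' f C =
    (\<Union>t \<in> C. tensor_kernel R M N'
               #>\<^bsub>free_Abelian_group (carrier M \<times> carrier N')\<^esub> tensor_lift f t)"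

section \<open>Flat modules and PF-rings\<close>

text \<open>A module is flat if tensoring with it preserves injectivity of linear maps. HOL cannot quantify
  over modules of all types inside a definition, so the test modules have carriers in the type
  \<open>(nat \<Rightarrow> 'a) set\<close>, which contains an isomorphic copy of every countably generated module over a ring
  with elements in \<open>'a\<close>. The lemma \<open>flat_moduleD\<close> below shows that this is no restriction: injectivity
  is then preserved for test modules of arbitrary types.\<close>

definition flat_module :: "[('a, 'r) ring_scheme, ('a, 'b, 'm) module_scheme] \<Rightarrow> bool"
  where "flat_module R M \<longleftrightarrow> module R M \<and>
    (\<forall>(N :: ('a, (nat \<Rightarrow> 'a) set) module) (N' :: ('a, (nat \<Rightarrow> 'a) set) module) f.
       module R N \<longrightarrow> module R N' \<longrightarrow> f \<in> module_hom R N N' \<longrightarrow> inj_on f (carrier N) \<longrightarrow>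
       inj_on (tensor_map R M N N' f) (carrier (tensor_product R M N)))"

text \<open>The fields \<open>mult\<close> and \<open>one\<close> are inherited by the record type of modules from that of rings;
  they play no role in the notion of a module.\<close>

definition ideal_module :: "[('a, 'r) ring_scheme, 'a set] \<Rightarrow> ('a, 'a) module"
  where "ideal_module R J =
    \<lparr>carrier = J, monoid.mult = (\<otimes>\<^bsub>R\<^esub>), monoid.one = \<one>\<^bsub>R\<^esub>,
     ring.zero = \<zero>\<^bsub>R\<^esub>, ring.add = (\<oplus>\<^bsub>R\<^esub>), smult = (\<otimes>\<^bsub>R\<^esub>)\<rparr>"

definition PF_ring :: "('a, 'r) ring_scheme \<Rightarrow> bool"
  where "PF_ring R \<longleftrightarrow> cring R \<and>
    (\<forall>a \<in> carrier R. flat_module R (ideal_module R (PIdl\<^bsub>R\<^esub> a)))"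


section \<open>Primary ideals\<close>

definition primary_ideal :: "['a set, ('a, 'r) ring_scheme] \<Rightarrow> bool"
  where "primary_ideal I R \<longleftrightarrow> ideal I R \<and> I \<noteq> carrier R \<and>
    (\<forall>a \<in> carrier R. \<forall>b \<in> carrier R.
       a \<otimes>\<^bsub>R\<^esub> b \<in> I \<longrightarrow> a \<in> I \<or> (\<exists>n::nat. n > 0 \<and> b [^]\<^bsub>R\<^esub> n \<in> I))"


section \<open>Dedekind domains\<close>

text \<open>The fraction \<open>a / b\<close> as an equivalence class of pairs.\<close>

definition fraction :: "[('a, 'r) ring_scheme, 'a, 'a] \<Rightarrow> ('a \<times> 'a) set"
  where "fraction R a b =
    {(c, d). c \<in> carrier R \<and> d \<in> carrier R - {\<zero>\<^bsub>R\<^esub>} \<and> a \<otimes>\<^bsub>R\<^esub> d = c \<otimes>\<^bsub>R\<^esub> b}"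

text \<open>The sets joined in \<open>mult\<close> and \<open>add\<close> are all equal, see \<open>fraction_mult\<close> and
  \<open>fraction_add\<close>.\<close>

definition fraction_field :: "('a, 'r) ring_scheme \<Rightarrow> ('a \<times> 'a) set ring"
  where "fraction_field R =
    \<lparr>carrier = {fraction R a b | a b. a \<in> carrier R \<and> b \<in> carrier R - {\<zero>\<^bsub>R\<^esub>}},
     monoid.mult = (\<lambda>p q. \<Union>(a, b) \<in> p. \<Union>(c, d) \<in> q. fraction R (a \<otimes>\<^bsub>R\<^esub> c) (b \<otimes>\<^bsub>R\<^esub> d)),
     monoid.one = fraction R \<one>\<^bsub>R\<^esub> \<one>\<^bsub>R\<^esub>,
     ring.zero = fraction R \<zero>\<^bsub>R\<^esub> \<one>\<^bsub>R\<^esub>,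
     ring.add = (\<lambda>p q. \<Union>(a, b) \<in> p. \<Union>(c, d) \<in> q.
              fraction R (a \<otimes>\<^bsub>R\<^esub> d \<oplus>\<^bsub>R\<^esub> c \<otimes>\<^bsub>R\<^esub> b) (b \<otimes>\<^bsub>R\<^esub> d))\<rparr>"

text \<open>Polynomials are lists of coefficients, leading coefficient first, so \<open>\<one> # cs\<close> is monic.\<close>

definition integral_element :: "[('k, 'm) ring_scheme, 'k set, 'k] \<Rightarrow> bool"
  where "integral_element K A x \<longleftrightarrow>
    (\<exists>cs. set cs \<subseteq> A \<and> ring.eval K (\<one>\<^bsub>K\<^esub> # cs) x = \<zero>\<^bsub>K\<^esub>)"

definition integrally_closed_domain :: "('a, 'r) ring_scheme \<Rightarrow> bool"
  where "integrally_closed_domain R \<longleftrightarrow> domain R \<and>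
    (\<forall>x \<in> carrier (fraction_field R).
       integral_element (fraction_field R) ((\<lambda>a. fraction R a \<one>\<^bsub>R\<^esub>) ` carrier R) x \<longrightarrow>
       x \<in> (\<lambda>a. fraction R a \<one>\<^bsub>R\<^esub>) ` carrier R)"

text \<open>Fields are included, as the Dedekind domains of dimension zero.\<close>

definition Dedekind_domain :: "('a, 'r) ring_scheme \<Rightarrow> bool"
  where "Dedekind_domain R \<longleftrightarrow> noetherian_domain R \<and> integrally_closed_domain R \<and>
    (\<forall>P. primeideal P R \<longrightarrow> P \<noteq> {\<zero>\<^bsub>R\<^esub>} \<longrightarrow> maximalideal P R)"


section \<open>Flatness does not depend on the type of the test modules\<close>

lemma module_homD:
  assumes "f \<in> module_hom R M N"
  shows "\<And>x. x \<in> carrier M \<Longrightarrow> f x \<in> carrier N"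
    and "\<And>x y. x \<in> carrier M \<Longrightarrow> y \<in> carrier M \<Longrightarrow> f (x \<oplus>\<^bsub>M\<^esub> y) = f x \<oplus>\<^bsub>N\<^esub> f y"
    and "\<And>a x. a \<in> carrier R \<Longrightarrow> x \<in> carrier M \<Longrightarrow> f (a \<odot>\<^bsub>M\<^esub> x) = a \<odot>\<^bsub>N\<^esub> f x"
  using assms by (auto simp: module_hom_def)

lemma tensor_lift_simps [simp]:
  "tensor_lift f 0 = 0"
  "tensor_lift f (frag_of (x, y)) = frag_of (x, f y)"
  "tensor_lift f (s + t) = tensor_lift f s + tensor_lift f t"
  "tensor_lift f (s - t) = tensor_lift f s - tensor_lift f t"
  "tensor_lift f (- t) = - tensor_lift f t"
  by (simp_all add: tensor_lift_def frag_extend_add frag_extend_diff frag_extend_minus)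

lemma keys_tensor_lift:
  "Poly_Mapping.keys (tensor_lift f t) \<subseteq> (\<lambda>(x, y). (x, f y)) ` Poly_Mapping.keys t"
  using keys_frag_extend[of "\<lambda>(x, y). frag_of (x, f y)" t]
  by (force simp: tensor_lift_def)

lemma tensor_lift_closed:
  assumes "f ` carrier N \<subseteq> carrier N'"
    and "t \<in> carrier (free_Abelian_group (carrier M \<times> carrier N))"
  shows "tensor_lift f t \<in> carrier (free_Abelian_group (carrier M \<times> carrier N'))"
  using keys_tensor_lift[of f t] assms by fastforce

lemma tensor_lift_compose: "tensor_lift g (tensor_lift f t) = tensor_lift (g \<circ> f) t"
proof -
  have f: "(\<lambda>(x, y). frag_of (x, f y)) = frag_of \<circ> (\<lambda>(x, y). (x, f y))" by auto
  show ?thesis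
    unfolding tensor_lift_def f frag_extend_compose by (intro frag_extend_eq) auto
qed

lemma tensor_lift_cong:
  assumes "\<And>x y. (x, y) \<in> Poly_Mapping.keys t \<Longrightarrow> f y = g y"
  shows "tensor_lift f t = tensor_lift g t"
  unfolding tensor_lift_def using assms by (intro frag_extend_eq) auto

lemma tensor_lift_id: "tensor_lift (\<lambda>y. y) t = t"
proof -
  have "tensor_lift (\<lambda>y. y) t = frag_extend frag_of t"
    unfolding tensor_lift_def by (intro frag_extend_eq) auto
  also have "\<dots> = t" by (rule frag_expansion[symmetric])
  finally show ?thesis .
qed

lemma tensor_relationsI:
  "x \<in> carrier M \<Longrightarrow> x' \<in> carrier M \<Longrightarrow> y \<in> carrier N \<Longrightarrow>
    frag_of (x \<oplus>\<^bsub>M\<^esub> x', y) - (frag_of (x, y) + frag_of (x', y)) \<in> tensor_relations R M N"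
  "x \<in> carrier M \<Longrightarrow> y \<in> carrier N \<Longrightarrow> y' \<in> carrier N \<Longrightarrow>
    frag_of (x, y \<oplus>\<^bsub>N\<^esub> y') - (frag_of (x, y) + frag_of (x, y')) \<in> tensor_relations R M N"
  "a \<in> carrier R \<Longrightarrow> x \<in> carrier M \<Longrightarrow> y \<in> carrier N \<Longrightarrow>
    frag_of (a \<odot>\<^bsub>M\<^esub> x, y) - frag_of (x, a \<odot>\<^bsub>N\<^esub> y) \<in> tensor_relations R M N"
  unfolding tensor_relations_def by blast+

lemma keys_of_carrier:
  "A \<subseteq> carrier (free_Abelian_group S) \<Longrightarrow> t \<in> A \<Longrightarrow> Poly_Mapping.keys t \<subseteq> S"
  by (drule (1) subsetD) (simp only: carrier_free_Abelian_group_iff)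

lemma keys_add_diff_subset:
  fixes s t :: "'b \<Rightarrow>\<^sub>0 int"
  assumes "Poly_Mapping.keys s \<subseteq> A" "Poly_Mapping.keys t \<subseteq> A"
  shows "Poly_Mapping.keys (s - t) \<subseteq> A" "Poly_Mapping.keys (s + t) \<subseteq> A"
  using order_trans[OF keys_diff Un_least[OF assms]] order_trans[OF Poly_Mapping.keys_add Un_least[OF assms]]
  by blast+

lemma tensor_relations_subset:
  assumes "module R M" "module R N"
  shows "tensor_relations R M N \<subseteq> carrier (free_Abelian_group (carrier M \<times> carrier N))"
proof -
  interpret M: module R M by fact
  interpret N: module R N by fact
  show ?thesis
  proof
    fix t assume "t \<in> tensor_relations R M N"
    then have "Poly_Mapping.keys t \<subseteq> carrier M \<times> carrier N"
      unfolding tensor_relations_def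
    proof (elim UnE CollectE exE conjE)
      fix x x' y
      assume "t = frag_of (x \<oplus>\<^bsub>M\<^esub> x', y) - (frag_of (x, y) + frag_of (x', y))"
        and "x \<in> carrier M" "x' \<in> carrier M" "y \<in> carrier N"
      then show ?thesis
        by (simp only:) (intro keys_add_diff_subset; simp add: keys_frag_of)
    next
      fix x y y'
      assume "t = frag_of (x, y \<oplus>\<^bsub>N\<^esub> y') - (frag_of (x, y) + frag_of (x, y'))"
        and "x \<in> carrier M" "y \<in> carrier N" "y' \<in> carrier N"
      then show ?thesis
        by (simp only:) (intro keys_add_diff_subset; simp add: keys_frag_of)
    next
      fix a x y
      assume "t = frag_of (a \<odot>\<^bsub>M\<^esub> x, y) - frag_of (x, a \<odot>\<^bsub>N\<^esub> y)"
        and "a \<in> carrier R" "x \<in> carrier M" "y \<in> carrier N"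
      then show ?thesis
        by (simp only:) (intro keys_add_diff_subset; simp add: keys_frag_of)
    qed
    then show "t \<in> carrier (free_Abelian_group (carrier M \<times> carrier N))"
      by (rule carrier_free_Abelian_group_iff[THEN iffD2])
  qed
qed

lemma tensor_kernel_subset:
  assumes "module R M" "module R N" "t \<in> tensor_kernel R M N"
  shows "Poly_Mapping.keys t \<subseteq> carrier M \<times> carrier N"
  using keys_of_carrier[OF group.generate_incl[OF group_free_Abelian_group
      tensor_relations_subset[OF assms(1,2)]]] assms(3)
  unfolding tensor_kernel_def by blast

lemma tensor_kernel_zero: "0 \<in> tensor_kernel R M N"
  unfolding tensor_kernel_def
  using generate.one[of "free_Abelian_group (carrier M \<times> carrier N)" "tensor_relations R M N"] by simp

lemma tensor_kernel_add:
  "s \<in> tensor_kernel R M N \<Longrightarrow> t \<in> tensor_kernel R M N \<Longrightarrow> s + t \<in> tensor_kernel R M N"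
  unfolding tensor_kernel_def using generate.eng by fastforce

lemma tensor_kernel_uminus:
  assumes "module R M" "module R N" "t \<in> tensor_kernel R M N"
  shows "- t \<in> tensor_kernel R M N"
  using group.generate_m_inv_closed[OF group_free_Abelian_group tensor_relations_subset[OF assms(1,2)]]
    assms(3) tensor_kernel_subset[OF assms]
  by (fastforce simp: tensor_kernel_def)

lemma tensor_kernel_induct [consumes 3, case_names zero rel uminus add]:
  assumes "module R M" "module R N" "t \<in> tensor_kernel R M N"
    and "P 0"
    and "\<And>t. t \<in> tensor_relations R M N \<Longrightarrow> P t"
    and "\<And>t. t \<in> tensor_relations R M N \<Longrightarrow> P (- t)"
    and "\<And>s t. P s \<Longrightarrow> P t \<Longrightarrow> P (s + t)"
  shows "P t"
  using assms(3) unfolding tensor_kernel_def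
proof (induction t rule: generate.induct)
  case (inv h)
  then have "Poly_Mapping.keys h \<subseteq> carrier M \<times> carrier N"
    by (rule keys_of_carrier[OF tensor_relations_subset[OF assms(1,2)]])
  then show ?case using inv assms(6) by simp
next
  case one
  show ?case using assms(4) by simp
next
  case (incl h)
  then show ?case by (rule assms(5))
next
  case (eng h1 h2)
  then show ?case using assms(7) by simp
qed

lemma tensor_relations_lift:
  assumes "f \<in> module_hom R N N'" "t \<in> tensor_relations R M N"
  shows "tensor_lift f t \<in> tensor_relations R M N'"
  using assms(2) unfolding tensor_relations_def[of R M N]
proof (elim UnE CollectE exE conjE)
  fix x x' y
  assume "t = frag_of (x \<oplus>\<^bsub>M\<^esub> x', y) - (frag_of (x, y) + frag_of (x', y))"
    and "x \<in> carrier M" "x' \<in> carrier M" "y \<in> carrier N"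
  then show ?thesis
    using tensor_relationsI(1)[of x M x' "f y" N' R] module_homD[OF assms(1)] by simp
next
  fix x y y'
  assume "t = frag_of (x, y \<oplus>\<^bsub>N\<^esub> y') - (frag_of (x, y) + frag_of (x, y'))"
    and "x \<in> carrier M" "y \<in> carrier N" "y' \<in> carrier N"
  then show ?thesis
    using tensor_relationsI(2)[of x M "f y" N' "f y'" R] module_homD[OF assms(1)] by simp
next
  fix a x y
  assume "t = frag_of (a \<odot>\<^bsub>M\<^esub> x, y) - frag_of (x, a \<odot>\<^bsub>N\<^esub> y)"
    and "a \<in> carrier R" "x \<in> carrier M" "y \<in> carrier N"
  then show ?thesis
    using tensor_relationsI(3)[of a R x M "f y" N'] module_homD[OF assms(1)] by simp
qed

lemma tensor_kernel_rel: "t \<in> tensor_relations R M N \<Longrightarrow> t \<in> tensor_kernel R M N"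
  unfolding tensor_kernel_def by (rule generate.incl)

lemma tensor_kernel_lift:
  assumes "module R M" "module R N" "module R N'" "f \<in> module_hom R N N'"
    and "t \<in> tensor_kernel R M N"
  shows "tensor_lift f t \<in> tensor_kernel R M N'"
  using assms(1,2,5)
proof (induction rule: tensor_kernel_induct)
  case zero
  show ?case by (simp add: tensor_kernel_zero)
next
  case (rel t)
  then show ?case by (intro tensor_kernel_rel tensor_relations_lift[OF assms(4)])
next
  case (uminus t)
  then have "tensor_lift f t \<in> tensor_kernel R M N'"
    by (intro tensor_kernel_rel tensor_relations_lift[OF assms(4)])
  then show ?case using tensor_kernel_uminus assms by simp
next
  case (add s t)
  then show ?case by (simp add: tensor_kernel_add)
qed

lemma tensor_coset:
  "tensor_kernel R M N #>\<^bsub>free_Abelian_group S\<^esub> t = (\<lambda>k. k + t) ` tensor_kernel R M N"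
  by (auto simp: r_coset_def)

lemma tensor_coset_eq_iff:
  assumes "module R M" "module R N"
  shows "(\<lambda>k. k + s) ` tensor_kernel R M N = (\<lambda>k. k + t) ` tensor_kernel R M N \<longleftrightarrow>
    s - t \<in> tensor_kernel R M N" (is "?L \<longleftrightarrow> ?R")
proof
  assume ?L
  moreover have "s \<in> (\<lambda>k. k + s) ` tensor_kernel R M N"
    by (rule image_eqI[OF _ tensor_kernel_zero]) simp
  ultimately obtain k where "k \<in> tensor_kernel R M N" "s = k + t" by auto
  then show ?R by simp
next
  have *: "(\<lambda>k. k + s) ` tensor_kernel R M N \<subseteq> (\<lambda>k. k + t) ` tensor_kernel R M N"
    if "s - t \<in> tensor_kernel R M N" for s t
  proof
    fix u assume "u \<in> (\<lambda>k. k + s) ` tensor_kernel R M N"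
    then obtain k where "k \<in> tensor_kernel R M N" "u = k + s" by auto
    then have "k + (s - t) \<in> tensor_kernel R M N" "u = (k + (s - t)) + t"
      using that by (auto intro: tensor_kernel_add)
    then show "u \<in> (\<lambda>k. k + t) ` tensor_kernel R M N" by blast
  qed
  assume ?R
  moreover have "t - s \<in> tensor_kernel R M N"
    using tensor_kernel_uminus[OF assms \<open>?R\<close>] by simp
  ultimately show ?L using * by blast
qed

lemma tensor_map_coset:
  assumes "module R M" "module R N" "module R N'" "f \<in> module_hom R N N'"
  shows "tensor_map R M N N' f (tensor_kernel R M N #>\<^bsub>free_Abelian_group (carrier M \<times> carrier N)\<^esub> t) =
    tensor_kernel R M N' #>\<^bsub>free_Abelian_group (carrier M \<times> carrier N')\<^esub> tensor_lift f t"
proof -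
  have "(\<lambda>k. k + tensor_lift f u) ` tensor_kernel R M N' =
      (\<lambda>k. k + tensor_lift f t) ` tensor_kernel R M N'"
    if u: "u \<in> (\<lambda>k. k + t) ` tensor_kernel R M N" for u
  proof -
    have "u - t \<in> tensor_kernel R M N" using u by auto
    then have "tensor_lift f (u - t) \<in> tensor_kernel R M N'"
      by (rule tensor_kernel_lift[OF assms])
    then show ?thesis by (simp add: tensor_coset_eq_iff[OF assms(1,3)])
  qed
  note eq = this
  have "t \<in> (\<lambda>k. k + t) ` tensor_kernel R M N"
    by (rule image_eqI[OF _ tensor_kernel_zero]) simp
  then have ne: "(\<lambda>k. k + t) ` tensor_kernel R M N \<noteq> {}" by blast
  show ?thesis
    unfolding tensor_map_def tensor_coset by (subst SUP_cong[OF refl eq]) (use ne in simp_all)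
qed

lemma inj_on_tensor_map_iff:
  assumes "module R M" "module R N" "module R N'" "f \<in> module_hom R N N'"
  shows "inj_on (tensor_map R M N N' f) (carrier (tensor_product R M N)) \<longleftrightarrow>
    (\<forall>t. Poly_Mapping.keys t \<subseteq> carrier M \<times> carrier N \<longrightarrow> tensor_lift f t \<in> tensor_kernel R M N' \<longrightarrow>
         t \<in> tensor_kernel R M N)" (is "?L \<longleftrightarrow> ?R")
proof -
  let ?F = "free_Abelian_group (carrier M \<times> carrier N)"
  let ?c = "\<lambda>t. tensor_kernel R M N #>\<^bsub>?F\<^esub> t"
  have carr: "carrier (tensor_product R M N) = ?c ` carrier ?F"
    unfolding tensor_product_def by (rule carrier_FactGroup)
  have c_carr: "?c t \<in> carrier (tensor_product R M N)"
    if "Poly_Mapping.keys t \<subseteq> carrier M \<times> carrier N" for t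
    unfolding carr by (rule imageI) (use that in simp)
  have c_eq: "?c s = ?c t \<longleftrightarrow> s - t \<in> tensor_kernel R M N" for s t
    unfolding tensor_coset by (rule tensor_coset_eq_iff[OF assms(1,2)])
  have m_eq: "tensor_map R M N N' f (?c s) = tensor_map R M N N' f (?c t) \<longleftrightarrow>
      tensor_lift f (s - t) \<in> tensor_kernel R M N'" for s t
    unfolding tensor_map_coset[OF assms]
    by (simp add: tensor_coset tensor_coset_eq_iff[OF assms(1,3)])
  show ?thesis
  proof
    assume L: ?L
    show ?R
    proof (intro allI impI)
      fix t assume t: "Poly_Mapping.keys t \<subseteq> carrier M \<times> carrier N"
        "tensor_lift f t \<in> tensor_kernel R M N'"
      have "tensor_map R M N N' f (?c t) = tensor_map R M N N' f (?c 0)"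
        using t by (subst m_eq) simp
      then have "?c t = ?c 0"
        by (rule inj_onD[OF L]) (use t in \<open>simp_all add: c_carr\<close>)
      then show "t \<in> tensor_kernel R M N" unfolding c_eq by simp
    qed
  next
    assume R: ?R
    show ?L
    proof (rule inj_onI)
      fix p q assume "p \<in> carrier (tensor_product R M N)" "q \<in> carrier (tensor_product R M N)"
        and eq: "tensor_map R M N N' f p = tensor_map R M N N' f q"
      then obtain s t where st: "p = ?c s" "q = ?c t" "s \<in> carrier ?F" "t \<in> carrier ?F"
        unfolding carr by auto
      then have "Poly_Mapping.keys (s - t) \<subseteq> carrier M \<times> carrier N"
        using keys_diff[of s t] by auto
      then show "p = q" using R eq st by (auto simp: m_eq c_eq)
    qed
  qed
qed


lemma module_hom_compose:
  "f \<in> module_hom R M N \<Longrightarrow> g \<in> module_hom R N N' \<Longrightarrow> g \<circ> f \<in> module_hom R M N'"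
  by (auto simp: module_hom_def Pi_iff)

lemma module_hom_cong:
  assumes "f \<in> module_hom R M N" "module R M" "\<And>x. x \<in> carrier M \<Longrightarrow> g x = f x"
  shows "g \<in> module_hom R M N"
proof -
  interpret module R M by fact
  show ?thesis using module_homD[OF assms(1)] assms(3) by (auto simp: module_hom_def)
qed

lemma module_hom_submodule:
  assumes "f \<in> module_hom R N N'" "G \<subseteq> carrier N" "f ` G \<subseteq> H"
  shows "f \<in> module_hom R (N\<lparr>carrier := G\<rparr>) (N'\<lparr>carrier := H\<rparr>)"
  using module_homD[OF assms(1)] assms(2,3) by (auto simp: module_hom_def subset_iff)

lemma tensor_relations_finite_support:
  assumes "t \<in> tensor_relations R M N"
  shows "\<exists>S. finite S \<and> S \<subseteq> carrier N \<and>
    (\<forall>H. S \<subseteq> H \<longrightarrow> t \<in> tensor_relations R M (N\<lparr>carrier := H\<rparr>))"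
  using assms unfolding tensor_relations_def[of R M N]
proof (elim UnE CollectE exE conjE)
  fix x x' y
  assume "t = frag_of (x \<oplus>\<^bsub>M\<^esub> x', y) - (frag_of (x, y) + frag_of (x', y))"
    and "x \<in> carrier M" "x' \<in> carrier M" "y \<in> carrier N"
  then show ?thesis
    using tensor_relationsI(1)[of x M x' y "N\<lparr>carrier := H\<rparr>" R for H]
    by (intro exI[of _ "{y}"]) simp
next
  fix x y y'
  assume "t = frag_of (x, y \<oplus>\<^bsub>N\<^esub> y') - (frag_of (x, y) + frag_of (x, y'))"
    and "x \<in> carrier M" "y \<in> carrier N" "y' \<in> carrier N"
  then show ?thesis
    using tensor_relationsI(2)[of x M y "N\<lparr>carrier := H\<rparr>" y' R for H]
    by (intro exI[of _ "{y, y'}"]) simp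
next
  fix a x y
  assume "t = frag_of (a \<odot>\<^bsub>M\<^esub> x, y) - frag_of (x, a \<odot>\<^bsub>N\<^esub> y)"
    and "a \<in> carrier R" "x \<in> carrier M" "y \<in> carrier N"
  then show ?thesis
    using tensor_relationsI(3)[of a R x M y "N\<lparr>carrier := H\<rparr>" for H]
    by (intro exI[of _ "{y}"]) simp
qed

lemma tensor_kernel_finite_support:
  assumes "module R M" "module R N" "t \<in> tensor_kernel R M N"
  shows "\<exists>S. finite S \<and> S \<subseteq> carrier N \<and>
    (\<forall>H. submodule H R N \<longrightarrow> S \<subseteq> H \<longrightarrow> t \<in> tensor_kernel R M (N\<lparr>carrier := H\<rparr>))"
  using assms
proof (induction rule: tensor_kernel_induct)
  case zero
  show ?case by (intro exI[of _ "{}"]) (simp add: tensor_kernel_zero)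
next
  case (rel t)
  from tensor_relations_finite_support[OF rel] obtain S where
    S: "finite S" "S \<subseteq> carrier N" "\<And>H. S \<subseteq> H \<Longrightarrow> t \<in> tensor_relations R M (N\<lparr>carrier := H\<rparr>)"
    by blast
  then show ?case by (intro exI[of _ S]) (simp add: tensor_kernel_rel)
next
  case (uminus t)
  from tensor_relations_finite_support[OF uminus] obtain S where
    S: "finite S" "S \<subseteq> carrier N" "\<And>H. S \<subseteq> H \<Longrightarrow> t \<in> tensor_relations R M (N\<lparr>carrier := H\<rparr>)"
    by blast
  have "- t \<in> tensor_kernel R M (N\<lparr>carrier := H\<rparr>)" if "submodule H R N" "S \<subseteq> H" for H
    using tensor_kernel_uminus[OF assms(1) submodule.submodule_is_module[OF that(1) assms(2)]
        tensor_kernel_rel[OF S(3)[OF that(2)]]] .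
  then show ?case using S(1,2) by (intro exI[of _ S]) simp
next
  case (add s t)
  then obtain S T where
    S: "finite S" "S \<subseteq> carrier N"
      "\<And>H. submodule H R N \<Longrightarrow> S \<subseteq> H \<Longrightarrow> s \<in> tensor_kernel R M (N\<lparr>carrier := H\<rparr>)" and
    T: "finite T" "T \<subseteq> carrier N"
      "\<And>H. submodule H R N \<Longrightarrow> T \<subseteq> H \<Longrightarrow> t \<in> tensor_kernel R M (N\<lparr>carrier := H\<rparr>)"
    by blast
  have "s + t \<in> tensor_kernel R M (N\<lparr>carrier := H\<rparr>)"
    if "submodule H R N" "S \<union> T \<subseteq> H" for H
    using S(3)[OF that(1)] T(3)[OF that(1)] that(2) by (intro tensor_kernel_add) auto
  then show ?case using S(1,2) T(1,2) by (intro exI[of _ "S \<union> T"]) simp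
qed

lemma module_copy:
  fixes H :: "('a, 'c, 'm) module_scheme" and \<phi> :: "'c \<Rightarrow> 'u"
  assumes "module R H" "inj_on \<phi> (carrier H)"
  obtains H' :: "('a, 'u) module"
  where "module R H'" "carrier H' = \<phi> ` carrier H" "\<phi> \<in> module_hom R H H'"
    "the_inv_into (carrier H) \<phi> \<in> module_hom R H' H"
proof -
  interpret module R H by fact
  let ?g = "the_inv_into (carrier H) \<phi>"
  define H' :: "('a, 'u) module" where "H' =
    \<lparr>carrier = \<phi> ` carrier H, monoid.mult = (\<lambda>_ _. undefined), monoid.one = undefined,
     ring.zero = \<phi> \<zero>\<^bsub>H\<^esub>, ring.add = (\<lambda>x y. \<phi> (?g x \<oplus>\<^bsub>H\<^esub> ?g y)),
     smult = (\<lambda>a x. \<phi> (a \<odot>\<^bsub>H\<^esub> ?g x))\<rparr>"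
  have g [simp]: "?g (\<phi> x) = x" if "x \<in> carrier H" for x
    using the_inv_into_f_f[OF assms(2) that] .
  have "abelian_group H'"
  proof (rule abelian_groupI)
    fix x assume "x \<in> carrier H'"
    then obtain x' where "x = \<phi> x'" "x' \<in> carrier H" by (auto simp: H'_def)
    then show "\<exists>y\<in>carrier H'. y \<oplus>\<^bsub>H'\<^esub> x = \<zero>\<^bsub>H'\<^esub>"
      by (intro bexI[of _ "\<phi> (\<ominus>\<^bsub>H\<^esub> x')"]) (auto simp: H'_def M.l_neg)
  qed (auto simp: H'_def M.a_ac)
  then have "module R H'"
    by (intro moduleI R.is_cring)
      (auto simp: H'_def smult_l_distr smult_r_distr smult_assoc1)
  moreover have "\<phi> \<in> module_hom R H H'"
    by (auto simp: H'_def module_hom_def)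
  moreover have "?g \<in> module_hom R H' H"
    by (auto simp: H'_def module_hom_def)
  ultimately show ?thesis by (intro that[of H']) (auto simp: H'_def)
qed

lemma finite_span:
  fixes R :: "('a, 'r) ring_scheme" and N :: "('a, 'c, 'm) module_scheme"
  assumes "module R N" "finite S" "S \<subseteq> carrier N"
  obtains H and \<phi> :: "'c \<Rightarrow> (nat \<Rightarrow> 'a) set"
  where "submodule H R N" "S \<subseteq> H" "inj_on \<phi> H"
proof -
  interpret module R N by fact
  obtain n :: nat and s where s: "S = s ` {i. i < n}"
    using finite_imp_nat_seg_image_inj_on[OF assms(2)] by metis
  define L where "L c = (\<Oplus>\<^bsub>N\<^esub>i\<in>{..<n}. c i \<odot>\<^bsub>N\<^esub> s i)" for c
  let ?C = "{..<n} \<rightarrow> carrier R"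
  have s_in: "s i \<in> carrier N" if "i < n" for i
    using assms(3) s that by auto
  have cs_in: "(\<lambda>i. c i \<odot>\<^bsub>N\<^esub> s i) \<in> {..<n} \<rightarrow> carrier N" if "c \<in> ?C" for c
    using that s_in by auto
  have L_smult: "a \<odot>\<^bsub>N\<^esub> L c = L (\<lambda>i. a \<otimes>\<^bsub>R\<^esub> c i)" if "a \<in> carrier R" "c \<in> ?C" for a c
    unfolding L_def finsum_smult_ldistr[OF finite_lessThan that(1) cs_in[OF that(2)]]
    by (intro M.finsum_cong') (use that s_in in \<open>auto simp: smult_assoc1[symmetric] Pi_iff\<close>)
  have L_add: "L c \<oplus>\<^bsub>N\<^esub> L d = L (\<lambda>i. c i \<oplus>\<^bsub>R\<^esub> d i)" if "c \<in> ?C" "d \<in> ?C" for c d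
    unfolding L_def M.finsum_addf[OF cs_in[OF that(1)] cs_in[OF that(2)], symmetric]
    by (intro M.finsum_cong') (use that s_in in \<open>auto simp: smult_l_distr[symmetric] Pi_iff\<close>)
  have L_in: "L c \<in> carrier N" if "c \<in> ?C" for c
    unfolding L_def by (rule M.finsum_closed[OF cs_in[OF that]])
  have smult_in: "a \<odot>\<^bsub>N\<^esub> x \<in> L ` ?C" if "a \<in> carrier R" "x \<in> L ` ?C" for a x
    using that by (auto simp: L_smult Pi_iff intro!: imageI)
  have sub: "submodule (L ` ?C) R N"
  proof (rule submoduleI)
    show "L ` ?C \<subseteq> carrier N" using L_in by auto
    have "L (\<lambda>_. \<zero>\<^bsub>R\<^esub>) = \<zero>\<^bsub>N\<^esub>"
      using s_in unfolding L_def by (intro M.add.finprod_one_eqI) auto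
    then show "\<zero>\<^bsub>N\<^esub> \<in> L ` ?C" by (intro image_eqI[of _ _ "\<lambda>_. \<zero>\<^bsub>R\<^esub>"]) auto
  next
    fix x assume x: "x \<in> L ` ?C"
    then have "\<ominus>\<^bsub>N\<^esub> x = (\<ominus>\<^bsub>R\<^esub> \<one>\<^bsub>R\<^esub>) \<odot>\<^bsub>N\<^esub> x" using L_in by (auto simp: smult_l_minus)
    then show "\<ominus>\<^bsub>N\<^esub> x \<in> L ` ?C" using smult_in x by simp
  next
    fix x y assume "x \<in> L ` ?C" "y \<in> L ` ?C"
    then show "x \<oplus>\<^bsub>N\<^esub> y \<in> L ` ?C" by (auto simp: L_add Pi_iff intro!: imageI)
  qed (rule smult_in)
  have "S \<subseteq> L ` ?C"
  proof
    fix x assume "x \<in> S"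
    then obtain j where j: "j < n" "x = s j" using s by auto
    have "L (\<lambda>i. if j = i then \<one>\<^bsub>R\<^esub> else \<zero>\<^bsub>R\<^esub>) = (\<Oplus>\<^bsub>N\<^esub>i\<in>{..<n}. if j = i then s i else \<zero>\<^bsub>N\<^esub>)"
      unfolding L_def using s_in by (intro M.finsum_cong') auto
    also have "\<dots> = s j"
      by (rule M.finsum_singleton) (use j s_in in auto)
    finally show "x \<in> L ` ?C"
      using j by (intro image_eqI[of _ _ "\<lambda>i. if j = i then \<one>\<^bsub>R\<^esub> else \<zero>\<^bsub>R\<^esub>"]) auto
  qed
  moreover have "inj_on (\<lambda>x. {c \<in> ?C. L c = x}) (L ` ?C)"
    by (rule inj_onI) blast
  ultimately show ?thesis using sub that by blast
qed

theorem flat_moduleD: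
  fixes R :: "('a, 'r) ring_scheme" and M :: "('a, 'b, 'm) module_scheme"
    and N :: "('a, 'c, 'n) module_scheme" and N' :: "('a, 'd, 'k) module_scheme"
  assumes "flat_module R M" "module R N" "module R N'" "f \<in> module_hom R N N'" "inj_on f (carrier N)"
  shows "inj_on (tensor_map R M N N' f) (carrier (tensor_product R M N))"
proof -
  have M: "module R M" using assms(1) by (simp add: flat_module_def)
  interpret N: module R N by fact
  interpret N': module R N' by fact
  show ?thesis
    unfolding inj_on_tensor_map_iff[OF M assms(2-4)]
  proof (intro allI impI)
    fix t assume t: "Poly_Mapping.keys t \<subseteq> carrier M \<times> carrier N"
      and ft: "tensor_lift f t \<in> tensor_kernel R M N'"
    obtain S where S: "finite S" "S \<subseteq> carrier N'"
        "\<And>H. submodule H R N' \<Longrightarrow> S \<subseteq> H \<Longrightarrow> tensor_lift f t \<in> tensor_kernel R M (N'\<lparr>carrier := H\<rparr>)"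
      using tensor_kernel_finite_support[OF M assms(3) ft] by blast
    let ?T = "S \<union> f ` snd ` Poly_Mapping.keys t"
    have T: "finite ?T" "?T \<subseteq> carrier N'"
      using S(1,2) t module_homD(1)[OF assms(4)] by auto
    obtain H and \<phi> :: "'d \<Rightarrow> (nat \<Rightarrow> 'a) set"
      where H: "submodule H R N'" "?T \<subseteq> H" "inj_on \<phi> H"
      by (rule finite_span[OF assms(3) T])
    let ?N1 = "N'\<lparr>carrier := H\<rparr>"
    define G where "G = {y \<in> carrier N. f y \<in> H}"
    let ?N0 = "N\<lparr>carrier := G\<rparr>"
    note HE = N'.submoduleE[OF H(1)]
    have f0: "f \<zero>\<^bsub>N\<^esub> = \<zero>\<^bsub>N'\<^esub>"
      using module_homD(3)[OF assms(4), of "\<zero>\<^bsub>R\<^esub>" "\<zero>\<^bsub>N\<^esub>"] module_homD(1)[OF assms(4), of "\<zero>\<^bsub>N\<^esub>"]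
      by simp
    have H0: "\<zero>\<^bsub>N'\<^esub> \<in> H"
      using HE(1,2) HE(4)[of "\<zero>\<^bsub>R\<^esub>"] N'.smult_l_null by fastforce
    have fm: "f (\<ominus>\<^bsub>N\<^esub> y) = \<ominus>\<^bsub>N'\<^esub> f y" if "y \<in> carrier N" for y
      using module_homD(3)[OF assms(4), of "\<ominus>\<^bsub>R\<^esub> \<one>\<^bsub>R\<^esub>" y] module_homD(1)[OF assms(4) that] that
      by (simp add: N.smult_l_minus N'.smult_l_minus)
    have "submodule G R N"
      by (rule N.submoduleI)
        (use HE H0 module_homD[OF assms(4)] in \<open>auto simp: G_def f0 fm\<close>)
    then have N0: "module R ?N0" by (rule submodule.submodule_is_module) fact
    have N1: "module R ?N1" using H(1) assms(3) by (rule submodule.submodule_is_module)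
    have f01: "f \<in> module_hom R ?N0 ?N1"
      by (rule module_hom_submodule[OF assms(4)]) (auto simp: G_def)
    have "inj_on f G" using assms(5) by (rule inj_on_subset) (auto simp: G_def)
    moreover have "inj_on \<phi> (f ` G)" using H(3) by (rule inj_on_subset) (auto simp: G_def)
    ultimately have inj: "inj_on (\<phi> \<circ> f) (carrier ?N0)" by (simp add: comp_inj_on)
    obtain H' :: "('a, (nat \<Rightarrow> 'a) set) module"
      where H': "module R H'" "carrier H' = \<phi> ` carrier ?N1" "\<phi> \<in> module_hom R ?N1 H'"
      by (rule module_copy[OF N1, of \<phi>]) (use H(3) in simp_all)
    obtain G' :: "('a, (nat \<Rightarrow> 'a) set) module"
      where G': "module R G'" "carrier G' = (\<phi> \<circ> f) ` carrier ?N0"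
        "\<phi> \<circ> f \<in> module_hom R ?N0 G'"
        "the_inv_into (carrier ?N0) (\<phi> \<circ> f) \<in> module_hom R G' ?N0" (is "?g \<in> _")
      by (rule module_copy[OF N0 inj])
    have incl: "(\<lambda>y. y) \<in> module_hom R G' H'"
    proof (rule module_hom_cong[OF _ G'(1)])
      show "(\<phi> \<circ> f) \<circ> ?g \<in> module_hom R G' H'"
        by (intro module_hom_compose[OF G'(4)] module_hom_compose[OF f01] H'(3))
      show "y = ((\<phi> \<circ> f) \<circ> ?g) y" if "y \<in> carrier G'" for y
        using f_the_inv_into_f[OF inj] that G'(2) by simp
    qed
    have t0: "Poly_Mapping.keys t \<subseteq> carrier M \<times> carrier ?N0"
    proof
      fix u assume u: "u \<in> Poly_Mapping.keys t"
      then have "f (snd u) \<in> H" using H(2) by auto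
      then show "u \<in> carrier M \<times> carrier ?N0" using u t by (auto simp: G_def)
    qed
    let ?t' = "tensor_lift (\<phi> \<circ> f) t"
    have "tensor_lift f t \<in> tensor_kernel R M ?N1" using S(3)[OF H(1)] H(2) by simp
    then have "tensor_lift \<phi> (tensor_lift f t) \<in> tensor_kernel R M H'"
      by (rule tensor_kernel_lift[OF M N1 H'(1,3)])
    then have "tensor_lift (\<lambda>y. y) ?t' \<in> tensor_kernel R M H'"
      by (simp add: tensor_lift_id tensor_lift_compose)
    moreover have "Poly_Mapping.keys ?t' \<subseteq> carrier M \<times> carrier G'"
      using tensor_lift_closed[of "\<phi> \<circ> f" ?N0 G' t M] t0 G'(2) by simp
    moreover have "inj_on (tensor_map R M G' H' (\<lambda>y. y)) (carrier (tensor_product R M G'))"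
      using assms(1) G'(1) H'(1) incl by (simp add: flat_module_def)
    ultimately have "?t' \<in> tensor_kernel R M G'"
      unfolding inj_on_tensor_map_iff[OF M G'(1) H'(1) incl] by blast
    then have "tensor_lift ?g ?t' \<in> tensor_kernel R M ?N0"
      by (rule tensor_kernel_lift[OF M G'(1) N0 G'(4)])
    moreover have "tensor_lift ?g ?t' = tensor_lift (\<lambda>y. y) t"
      unfolding tensor_lift_compose
    proof (rule tensor_lift_cong)
      fix x y assume "(x, y) \<in> Poly_Mapping.keys t"
      then have "y \<in> carrier ?N0" using t0 by auto
      then show "(?g \<circ> (\<phi> \<circ> f)) y = y"
        using the_inv_into_f_f[OF inj] by simp
    qed
    ultimately have "t \<in> tensor_kernel R M ?N0" by (simp add: tensor_lift_id)
    moreover have "(\<lambda>y. y) \<in> module_hom R ?N0 N"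
      by (auto simp: module_hom_def G_def)
    ultimately have "tensor_lift (\<lambda>y. y) t \<in> tensor_kernel R M N"
      using tensor_kernel_lift[OF M N0 assms(2)] by blast
    then show "t \<in> tensor_kernel R M N" by (simp add: tensor_lift_id)
  qed
qed


section \<open>The field of fractions\<close>

lemma fraction_eq_iff:
  assumes "domain R" "a \<in> carrier R" "b \<in> carrier R - {\<zero>\<^bsub>R\<^esub>}" "c \<in> carrier R" "d \<in> carrier R - {\<zero>\<^bsub>R\<^esub>}"
  shows "fraction R a b = fraction R c d \<longleftrightarrow> a \<otimes>\<^bsub>R\<^esub> d = c \<otimes>\<^bsub>R\<^esub> b"
proof
  interpret domain R by fact
  assume "fraction R a b = fraction R c d"
  moreover have "(c, d) \<in> fraction R c d" using assms by (simp add: fraction_def)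
  ultimately have "(c, d) \<in> fraction R a b" by simp
  then show "a \<otimes>\<^bsub>R\<^esub> d = c \<otimes>\<^bsub>R\<^esub> b" by (simp add: fraction_def)
next
  interpret domain R by fact
  have *: "fraction R a b \<subseteq> fraction R c d"
    if eq: "a \<otimes>\<^bsub>R\<^esub> d = c \<otimes>\<^bsub>R\<^esub> b" and "a \<in> carrier R" "b \<in> carrier R - {\<zero>\<^bsub>R\<^esub>}" "c \<in> carrier R"
      "d \<in> carrier R - {\<zero>\<^bsub>R\<^esub>}" for a b c d
  proof (clarsimp simp: fraction_def)
    fix x y assume xy: "x \<in> carrier R" "y \<in> carrier R" "y \<noteq> \<zero>\<^bsub>R\<^esub>" "a \<otimes>\<^bsub>R\<^esub> y = x \<otimes>\<^bsub>R\<^esub> b"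
    have "b \<otimes>\<^bsub>R\<^esub> (c \<otimes>\<^bsub>R\<^esub> y) = (c \<otimes>\<^bsub>R\<^esub> b) \<otimes>\<^bsub>R\<^esub> y"
      using that(2-) xy(1-3) by (simp add: m_ac)
    also have "\<dots> = (a \<otimes>\<^bsub>R\<^esub> y) \<otimes>\<^bsub>R\<^esub> d" unfolding eq[symmetric] using that(2-) xy(1-3) by (simp add: m_ac)
    also have "\<dots> = b \<otimes>\<^bsub>R\<^esub> (x \<otimes>\<^bsub>R\<^esub> d)" unfolding xy(4) using that(2-) xy(1-3) by (simp add: m_ac)
    finally show "c \<otimes>\<^bsub>R\<^esub> y = x \<otimes>\<^bsub>R\<^esub> d"
      using that(2-) xy(1-3) by (simp add: m_lcancel)
  qed
  assume eq: "a \<otimes>\<^bsub>R\<^esub> d = c \<otimes>\<^bsub>R\<^esub> b"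
  show "fraction R a b = fraction R c d"
    using *[OF eq] *[OF eq[symmetric]] assms by blast
qed

lemma UN_pairs_const:
  assumes "(a, b) \<in> A" "(c, d) \<in> B"
    and "\<And>x y x' y'. (x, y) \<in> A \<Longrightarrow> (x', y') \<in> B \<Longrightarrow> F x y x' y' = C"
  shows "(\<Union>(x, y) \<in> A. \<Union>(x', y') \<in> B. F x y x' y') = C"
proof
  show "(\<Union>(x, y) \<in> A. \<Union>(x', y') \<in> B. F x y x' y') \<subseteq> C"
  proof
    fix z assume "z \<in> (\<Union>(x, y) \<in> A. \<Union>(x', y') \<in> B. F x y x' y')"
    then obtain x y x' y' where "(x, y) \<in> A" "(x', y') \<in> B" "z \<in> F x y x' y'" by auto
    then show "z \<in> C" using assms(3) by simp
  qed
  have "F a b c d \<subseteq> (\<Union>(x, y) \<in> A. \<Union>(x', y') \<in> B. F x y x' y')"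
    using assms(1,2) by blast
  then show "C \<subseteq> (\<Union>(x, y) \<in> A. \<Union>(x', y') \<in> B. F x y x' y')"
    using assms(3)[OF assms(1,2)] by simp
qed

lemma fraction_mult:
  assumes "domain R" "a \<in> carrier R" "b \<in> carrier R - {\<zero>\<^bsub>R\<^esub>}" "c \<in> carrier R" "d \<in> carrier R - {\<zero>\<^bsub>R\<^esub>}"
  shows "fraction R a b \<otimes>\<^bsub>fraction_field R\<^esub> fraction R c d = fraction R (a \<otimes>\<^bsub>R\<^esub> c) (b \<otimes>\<^bsub>R\<^esub> d)"
proof -
  interpret domain R by fact
  have "fraction R (x \<otimes>\<^bsub>R\<^esub> x') (y \<otimes>\<^bsub>R\<^esub> y') = fraction R (a \<otimes>\<^bsub>R\<^esub> c) (b \<otimes>\<^bsub>R\<^esub> d)"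
    if "(x, y) \<in> fraction R a b" "(x', y') \<in> fraction R c d" for x y x' y'
  proof -
    have xy: "x \<in> carrier R" "y \<in> carrier R" "y \<noteq> \<zero>\<^bsub>R\<^esub>" "a \<otimes>\<^bsub>R\<^esub> y = x \<otimes>\<^bsub>R\<^esub> b"
      "x' \<in> carrier R" "y' \<in> carrier R" "y' \<noteq> \<zero>\<^bsub>R\<^esub>" "c \<otimes>\<^bsub>R\<^esub> y' = x' \<otimes>\<^bsub>R\<^esub> d"
      using that by (auto simp: fraction_def)
    have "(x \<otimes>\<^bsub>R\<^esub> x') \<otimes>\<^bsub>R\<^esub> (b \<otimes>\<^bsub>R\<^esub> d) = (x \<otimes>\<^bsub>R\<^esub> b) \<otimes>\<^bsub>R\<^esub> (x' \<otimes>\<^bsub>R\<^esub> d)"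
      using xy(1-3,5-7) assms by (simp add: m_ac)
    also have "\<dots> = (a \<otimes>\<^bsub>R\<^esub> c) \<otimes>\<^bsub>R\<^esub> (y \<otimes>\<^bsub>R\<^esub> y')"
      unfolding xy(4)[symmetric] xy(8)[symmetric] using xy(1-3,5-7) assms by (simp add: m_ac)
    finally show ?thesis
      using xy assms by (subst fraction_eq_iff[OF assms(1)]) (auto simp: integral_iff)
  qed
  note eq = this
  have ab: "(a, b) \<in> fraction R a b" and cd: "(c, d) \<in> fraction R c d"
    using assms by (simp_all add: fraction_def)
  show ?thesis
    unfolding fraction_field_def monoid.simps ring.simps by (rule UN_pairs_const[OF ab cd eq])
qed

lemma fraction_add:
  assumes "domain R" "a \<in> carrier R" "b \<in> carrier R - {\<zero>\<^bsub>R\<^esub>}" "c \<in> carrier R" "d \<in> carrier R - {\<zero>\<^bsub>R\<^esub>}"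
  shows "fraction R a b \<oplus>\<^bsub>fraction_field R\<^esub> fraction R c d =
    fraction R (a \<otimes>\<^bsub>R\<^esub> d \<oplus>\<^bsub>R\<^esub> c \<otimes>\<^bsub>R\<^esub> b) (b \<otimes>\<^bsub>R\<^esub> d)"
proof -
  interpret domain R by fact
  have "fraction R (x \<otimes>\<^bsub>R\<^esub> y' \<oplus>\<^bsub>R\<^esub> x' \<otimes>\<^bsub>R\<^esub> y) (y \<otimes>\<^bsub>R\<^esub> y') =
      fraction R (a \<otimes>\<^bsub>R\<^esub> d \<oplus>\<^bsub>R\<^esub> c \<otimes>\<^bsub>R\<^esub> b) (b \<otimes>\<^bsub>R\<^esub> d)"
    if "(x, y) \<in> fraction R a b" "(x', y') \<in> fraction R c d" for x y x' y'
  proof -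
    have xy: "x \<in> carrier R" "y \<in> carrier R" "y \<noteq> \<zero>\<^bsub>R\<^esub>" "a \<otimes>\<^bsub>R\<^esub> y = x \<otimes>\<^bsub>R\<^esub> b"
      "x' \<in> carrier R" "y' \<in> carrier R" "y' \<noteq> \<zero>\<^bsub>R\<^esub>" "c \<otimes>\<^bsub>R\<^esub> y' = x' \<otimes>\<^bsub>R\<^esub> d"
      using that by (auto simp: fraction_def)
    have "(x \<otimes>\<^bsub>R\<^esub> y' \<oplus>\<^bsub>R\<^esub> x' \<otimes>\<^bsub>R\<^esub> y) \<otimes>\<^bsub>R\<^esub> (b \<otimes>\<^bsub>R\<^esub> d) =
        (x \<otimes>\<^bsub>R\<^esub> b) \<otimes>\<^bsub>R\<^esub> (y' \<otimes>\<^bsub>R\<^esub> d) \<oplus>\<^bsub>R\<^esub> (x' \<otimes>\<^bsub>R\<^esub> d) \<otimes>\<^bsub>R\<^esub> (y \<otimes>\<^bsub>R\<^esub> b)"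
      using xy(1-3,5-7) assms by (simp add: l_distr r_distr m_ac)
    also have "\<dots> = (a \<otimes>\<^bsub>R\<^esub> d \<oplus>\<^bsub>R\<^esub> c \<otimes>\<^bsub>R\<^esub> b) \<otimes>\<^bsub>R\<^esub> (y \<otimes>\<^bsub>R\<^esub> y')"
      unfolding xy(4)[symmetric] xy(8)[symmetric] using xy(1-3,5-7) assms by (simp add: l_distr r_distr m_ac)
    finally show ?thesis
      using xy assms by (subst fraction_eq_iff[OF assms(1)]) (auto simp: integral_iff)
  qed
  note eq = this
  have ab: "(a, b) \<in> fraction R a b" and cd: "(c, d) \<in> fraction R c d"
    using assms by (simp_all add: fraction_def)
  show ?thesis
    unfolding fraction_field_def monoid.simps ring.simps by (rule UN_pairs_const[OF ab cd eq])
qed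

lemma fraction_field_is_field:
  assumes "domain R"
  shows "field (fraction_field R)"
proof -
  interpret domain R by fact
  let ?K = "fraction_field R"
  let ?D = "carrier R - {\<zero>\<^bsub>R\<^esub>}"
  have carr: "carrier ?K = {fraction R a b | a b. a \<in> carrier R \<and> b \<in> ?D}"
    and one: "\<one>\<^bsub>?K\<^esub> = fraction R \<one>\<^bsub>R\<^esub> \<one>\<^bsub>R\<^esub>" and zero: "\<zero>\<^bsub>?K\<^esub> = fraction R \<zero>\<^bsub>R\<^esub> \<one>\<^bsub>R\<^esub>"
    by (simp_all add: fraction_field_def)
  have D: "x \<otimes>\<^bsub>R\<^esub> y \<in> ?D" if "x \<in> ?D" "y \<in> ?D" for x y
    using that by (auto simp: integral_iff)
  have K: "\<exists>a b. x = fraction R a b \<and> a \<in> carrier R \<and> b \<in> ?D" if "x \<in> carrier ?K" for x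
    using that by (auto simp: carr)
  have in_K: "fraction R a b \<in> carrier ?K" if "a \<in> carrier R" "b \<in> ?D" for a b
    using that by (auto simp: carr)
  note eq = fraction_eq_iff[OF assms] and ml = fraction_mult[OF assms] and ad = fraction_add[OF assms]
  have D1: "\<one>\<^bsub>R\<^esub> \<in> ?D" by simp
  have grp: "abelian_group ?K"
  proof (rule abelian_groupI)
    fix x y assume "x \<in> carrier ?K" "y \<in> carrier ?K"
    then obtain a b c d where *: "x = fraction R a b" "a \<in> carrier R" "b \<in> ?D"
      "y = fraction R c d" "c \<in> carrier R" "d \<in> ?D" using K by metis
    show "x \<oplus>\<^bsub>?K\<^esub> y \<in> carrier ?K" using * D[of b d] by (simp add: ad in_K)
    show "x \<oplus>\<^bsub>?K\<^esub> y = y \<oplus>\<^bsub>?K\<^esub> x" using * D[of b d] D[of d b] by (simp add: ad a_comm m_comm)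
  next
    fix x y z assume "x \<in> carrier ?K" "y \<in> carrier ?K" "z \<in> carrier ?K"
    then obtain a b c d e f where *: "x = fraction R a b" "a \<in> carrier R" "b \<in> ?D"
      "y = fraction R c d" "c \<in> carrier R" "d \<in> ?D"
      "z = fraction R e f" "e \<in> carrier R" "f \<in> ?D" using K by metis
    show "x \<oplus>\<^bsub>?K\<^esub> y \<oplus>\<^bsub>?K\<^esub> z = x \<oplus>\<^bsub>?K\<^esub> (y \<oplus>\<^bsub>?K\<^esub> z)"
      using * D[of b d] D[of d f] by (simp add: ad l_distr r_distr m_ac a_ac)
  next
    show "\<zero>\<^bsub>?K\<^esub> \<in> carrier ?K" unfolding zero by (rule in_K) simp_all
  next
    fix x assume "x \<in> carrier ?K"
    then obtain a b where *: "x = fraction R a b" "a \<in> carrier R" "b \<in> ?D" using K by metis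
    show "\<zero>\<^bsub>?K\<^esub> \<oplus>\<^bsub>?K\<^esub> x = x" unfolding zero using * by (simp add: ad)
    have "fraction R (\<ominus>\<^bsub>R\<^esub> a) b \<oplus>\<^bsub>?K\<^esub> x = \<zero>\<^bsub>?K\<^esub>"
      unfolding zero using * D[of b b] by (simp add: ad eq l_minus l_neg)
    then show "\<exists>y\<in>carrier ?K. y \<oplus>\<^bsub>?K\<^esub> x = \<zero>\<^bsub>?K\<^esub>" by (rule bexI) (use * in \<open>simp add: in_K\<close>)
  qed
  have mon: "comm_monoid ?K"
  proof (rule comm_monoidI)
    fix x y assume "x \<in> carrier ?K" "y \<in> carrier ?K"
    then obtain a b c d where *: "x = fraction R a b" "a \<in> carrier R" "b \<in> ?D"
      "y = fraction R c d" "c \<in> carrier R" "d \<in> ?D" using K by metis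
    show "x \<otimes>\<^bsub>?K\<^esub> y \<in> carrier ?K" using * D[of b d] by (simp add: ml in_K)
    show "x \<otimes>\<^bsub>?K\<^esub> y = y \<otimes>\<^bsub>?K\<^esub> x" using * by (simp add: ml m_comm)
  next
    fix x y z assume "x \<in> carrier ?K" "y \<in> carrier ?K" "z \<in> carrier ?K"
    then obtain a b c d e f where *: "x = fraction R a b" "a \<in> carrier R" "b \<in> ?D"
      "y = fraction R c d" "c \<in> carrier R" "d \<in> ?D"
      "z = fraction R e f" "e \<in> carrier R" "f \<in> ?D" using K by metis
    show "x \<otimes>\<^bsub>?K\<^esub> y \<otimes>\<^bsub>?K\<^esub> z = x \<otimes>\<^bsub>?K\<^esub> (y \<otimes>\<^bsub>?K\<^esub> z)"
      using * D[of b d] D[of d f] by (simp add: ml m_ac)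
  next
    show "\<one>\<^bsub>?K\<^esub> \<in> carrier ?K" unfolding one by (rule in_K) simp_all
  next
    fix x assume "x \<in> carrier ?K"
    then obtain a b where *: "x = fraction R a b" "a \<in> carrier R" "b \<in> ?D" using K by metis
    show "\<one>\<^bsub>?K\<^esub> \<otimes>\<^bsub>?K\<^esub> x = x" unfolding one using * by (simp add: ml)
  qed
  interpret K: cring ?K
  proof (rule cringI[OF grp mon])
    fix x y z assume "x \<in> carrier ?K" "y \<in> carrier ?K" "z \<in> carrier ?K"
    then obtain a b c d e f where *: "x = fraction R a b" "a \<in> carrier R" "b \<in> ?D"
      "y = fraction R c d" "c \<in> carrier R" "d \<in> ?D"
      "z = fraction R e f" "e \<in> carrier R" "f \<in> ?D" using K by metis
    show "(x \<oplus>\<^bsub>?K\<^esub> y) \<otimes>\<^bsub>?K\<^esub> z = x \<otimes>\<^bsub>?K\<^esub> z \<oplus>\<^bsub>?K\<^esub> y \<otimes>\<^bsub>?K\<^esub> z"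
      using * D[of b d] D[of b f] D[of d f] D[of "b \<otimes>\<^bsub>R\<^esub> d" f] D[of "b \<otimes>\<^bsub>R\<^esub> f" "d \<otimes>\<^bsub>R\<^esub> f"]
      by (simp add: ad ml eq l_distr r_distr m_ac)
  qed
  show ?thesis
  proof (rule K.cring_fieldI2)
    show "\<zero>\<^bsub>?K\<^esub> \<noteq> \<one>\<^bsub>?K\<^esub>" unfolding zero one by (simp add: eq)
  next
    fix x assume x: "x \<in> carrier ?K" "x \<noteq> \<zero>\<^bsub>?K\<^esub>"
    then obtain a b where *: "x = fraction R a b" "a \<in> carrier R" "b \<in> ?D" using K by metis
    have "a \<in> ?D" using x(2) * by (auto simp: zero eq)
    then have "x \<otimes>\<^bsub>?K\<^esub> fraction R b a = \<one>\<^bsub>?K\<^esub>" "fraction R b a \<in> carrier ?K"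
      unfolding one using * D[of b a] by (simp_all add: ml eq in_K m_comm)
    then show "\<exists>y\<in>carrier ?K. x \<otimes>\<^bsub>?K\<^esub> y = \<one>\<^bsub>?K\<^esub>" by blast
  qed
qed

end

theory Submission
  imports Defs
begin

text \<open>Everything rests on a translation of flatness into a statement about elements. Write \<open>ann a\<close> for
  the annihilator of \<open>a\<close>.

  \<^item> If \<open>R a\<close> is flat, then \<open>ann a\<close> is pure: each \<open>b\<close> with \<open>a \<otimes> b = \<zero>\<close> satisfies \<open>b = b \<otimes> c\<close> for some
    \<open>c\<close> in \<open>ann a\<close>. Indeed the simple tensor of \<open>a\<close> and \<open>b\<close> dies in the tensor product of \<open>R a\<close> and
    \<open>R\<close>, hence by flatness already in that of \<open>R a\<close> and \<open>R b\<close>, and the latter is mapped to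
    \<open>R / (b \<otimes> ann a)\<close> so that this tensor goes to the class of \<open>b\<close>
    (\<open>flat_principal_ideal_imp_pure_annihilator\<close>).
  \<^item> If some \<open>e\<close> satisfies \<open>a \<otimes> e = a\<close> and is killed by all of \<open>ann a\<close>, then \<open>R a\<close> is a direct
    summand of \<open>R\<close>, hence flat (\<open>flat_principal_idealI\<close>). In a domain \<open>e\<close> is \<open>\<zero>\<close> or \<open>\<one>\<close>; in a
    von Neumann regular ring, where \<open>a = a \<otimes> a \<otimes> x\<close>, it is \<open>a \<otimes> x\<close>.

  For the statement on primary ideals: if \<open>I\<close> is prime, then \<open>R / I\<close> is a domain. Conversely let \<open>I\<close> be
  primary and \<open>a \<otimes> b\<close> in \<open>I\<close> with \<open>a\<close> outside \<open>I\<close>. Purity gives \<open>b = b \<otimes> c\<close> modulo \<open>I\<close> with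
  \<open>a \<otimes> c\<close> in \<open>I\<close>, so a power of \<open>c\<close> lies in \<open>I\<close>, and \<open>b = b \<otimes> c [^] n\<close> modulo \<open>I\<close> puts \<open>b\<close> in \<open>I\<close>.

  For the statement on Dedekind domains: if all exponents are \<open>1\<close>, then \<open>I\<close> is a finite intersection
  of maximal ideals, and \<open>R / I\<close> is von Neumann regular. Conversely, purity for \<open>b = a\<close> shows that a
  PF-ring is reduced. If \<open>P\<close> occurs with exponent at least two, write \<open>I = P \<cdot> J\<close> with \<open>J\<close> contained in
  \<open>P\<close>. Squares of elements of \<open>J\<close> lie in \<open>I\<close>, so \<open>J\<close> is contained in \<open>I = P \<cdot> J\<close>, and Nakayama's lemma
  in the Noetherian domain \<open>R\<close> forces \<open>J\<close>, hence \<open>I\<close>, to be zero.\<close>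

section \<open>Maps out of tensor products\<close>

lemma tensor_kernel_diff:
  assumes "module R M" "module R N" "s \<in> tensor_kernel R M N" "t \<in> tensor_kernel R M N"
  shows "s - t \<in> tensor_kernel R M N"
  using tensor_kernel_add[OF assms(3) tensor_kernel_uminus[OF assms(1,2,4)]] by simp

lemma frag_of_zero_left_in_tensor_kernel:
  assumes "module R M" "module R N" "y \<in> carrier N"
  shows "frag_of (\<zero>\<^bsub>M\<^esub>, y) \<in> tensor_kernel R M N"
proof -
  interpret M: module R M by fact
  have "frag_of (\<zero>\<^bsub>M\<^esub> \<oplus>\<^bsub>M\<^esub> \<zero>\<^bsub>M\<^esub>, y) - (frag_of (\<zero>\<^bsub>M\<^esub>, y) + frag_of (\<zero>\<^bsub>M\<^esub>, y))
      \<in> tensor_kernel R M N"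
    using assms(3) by (intro tensor_kernel_rel tensor_relationsI) auto
  from tensor_kernel_uminus[OF assms(1,2) this] show ?thesis by simp
qed

lemma frag_of_zero_right_in_tensor_kernel:
  assumes "module R M" "module R N" "x \<in> carrier M"
  shows "frag_of (x, \<zero>\<^bsub>N\<^esub>) \<in> tensor_kernel R M N"
proof -
  interpret N: module R N by fact
  have "frag_of (x, \<zero>\<^bsub>N\<^esub> \<oplus>\<^bsub>N\<^esub> \<zero>\<^bsub>N\<^esub>) - (frag_of (x, \<zero>\<^bsub>N\<^esub>) + frag_of (x, \<zero>\<^bsub>N\<^esub>))
      \<in> tensor_kernel R M N"
    using assms(3) by (intro tensor_kernel_rel tensor_relationsI) auto
  from tensor_kernel_uminus[OF assms(1,2) this] show ?thesis by simp
qed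

text \<open>One half of the universal property of the tensor product: a balanced biadditive map extends to
  formal sums and vanishes on the relations. It extracts information from the vanishing of a simple
  tensor, which the description of the kernel by generators does not show.\<close>

lemma balanced_map_kills_tensor_kernel:
  assumes M: "module R M" and N: "module R N" and A: "abelian_group A"
    and closed: "\<And>x y. x \<in> carrier M \<Longrightarrow> y \<in> carrier N \<Longrightarrow> \<phi> x y \<in> carrier A"
    and addl: "\<And>x x' y. x \<in> carrier M \<Longrightarrow> x' \<in> carrier M \<Longrightarrow> y \<in> carrier N \<Longrightarrow>
      \<phi> (x \<oplus>\<^bsub>M\<^esub> x') y = \<phi> x y \<oplus>\<^bsub>A\<^esub> \<phi> x' y"
    and addr: "\<And>x y y'. x \<in> carrier M \<Longrightarrow> y \<in> carrier N \<Longrightarrow> y' \<in> carrier N \<Longrightarrow>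
      \<phi> x (y \<oplus>\<^bsub>N\<^esub> y') = \<phi> x y \<oplus>\<^bsub>A\<^esub> \<phi> x y'"
    and balanced: "\<And>a x y. a \<in> carrier R \<Longrightarrow> x \<in> carrier M \<Longrightarrow> y \<in> carrier N \<Longrightarrow>
      \<phi> (a \<odot>\<^bsub>M\<^esub> x) y = \<phi> x (a \<odot>\<^bsub>N\<^esub> y)"
    and xy: "x \<in> carrier M" "y \<in> carrier N" "frag_of (x, y) \<in> tensor_kernel R M N"
  shows "\<phi> x y = \<zero>\<^bsub>A\<^esub>"
proof -
  interpret M: module R M by fact
  interpret N: module R N by fact
  interpret A: abelian_group A by fact
  let ?S = "carrier M \<times> carrier N"
  obtain h where h: "h \<in> hom (free_Abelian_group ?S) (add_monoid A)"
    and h_frag: "\<And>p. p \<in> ?S \<Longrightarrow> h (frag_of p) = (\<lambda>(x, y). \<phi> x y) p"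
    by (rule comm_group.free_Abelian_group_universal[OF A.a_comm_group, of "\<lambda>(x, y). \<phi> x y" ?S])
      (use closed in auto)
  interpret h: group_hom "free_Abelian_group ?S" "add_monoid A" h
    by (simp add: group_hom_def group_hom_axioms_def h A.a_group)
  have frag [simp]: "h (frag_of (u, v)) = \<phi> u v" if "u \<in> carrier M" "v \<in> carrier N" for u v
    using h_frag[of "(u, v)"] that by simp
  have h_add: "h (s + t) = h s \<oplus>\<^bsub>A\<^esub> h t"
    if "Poly_Mapping.keys s \<subseteq> ?S" "Poly_Mapping.keys t \<subseteq> ?S" for s t
    using h.hom_mult[of s t] that by simp
  have minus: "h (- t) = \<ominus>\<^bsub>A\<^esub> h t" if "Poly_Mapping.keys t \<subseteq> ?S" for t
    using h.hom_inv[of t] that by (simp add: a_inv_def)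
  have diff: "h (s - t) = h s \<ominus>\<^bsub>A\<^esub> h t"
    if "Poly_Mapping.keys s \<subseteq> ?S" "Poly_Mapping.keys t \<subseteq> ?S" for s t
    using h_add[of s "- t"] minus[of t] that by (simp add: A.minus_eq)
  have h_rel: "h t = \<zero>\<^bsub>A\<^esub>" if "t \<in> tensor_relations R M N" for t
    using that unfolding tensor_relations_def
  proof (elim UnE CollectE exE conjE)
    fix x x' y
    assume t: "t = frag_of (x \<oplus>\<^bsub>M\<^esub> x', y) - (frag_of (x, y) + frag_of (x', y))"
      and "x \<in> carrier M" "x' \<in> carrier M" "y \<in> carrier N"
    then show ?thesis unfolding t
      by (subst diff; simp add: addl closed A.r_neg A.minus_eq
          order_trans[OF Poly_Mapping.keys_add] keys_frag_of h_add)
  next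
    fix x y y'
    assume t: "t = frag_of (x, y \<oplus>\<^bsub>N\<^esub> y') - (frag_of (x, y) + frag_of (x, y'))"
      and "x \<in> carrier M" "y \<in> carrier N" "y' \<in> carrier N"
    then show ?thesis unfolding t
      by (subst diff; simp add: addr closed A.r_neg A.minus_eq
          order_trans[OF Poly_Mapping.keys_add] keys_frag_of h_add)
  next
    fix a x y
    assume t: "t = frag_of (a \<odot>\<^bsub>M\<^esub> x, y) - frag_of (x, a \<odot>\<^bsub>N\<^esub> y)"
      and "a \<in> carrier R" "x \<in> carrier M" "y \<in> carrier N"
    then show ?thesis unfolding t
      by (subst diff; simp add: balanced closed A.r_neg A.minus_eq keys_frag_of)
  qed
  have "Poly_Mapping.keys t \<subseteq> ?S \<and> h t = \<zero>\<^bsub>A\<^esub>" if "t \<in> tensor_kernel R M N" for t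
    using M N that
  proof (induction rule: tensor_kernel_induct)
    case zero
    then show ?case using h.hom_one by simp
  next
    case (rel t)
    then show ?case
      using h_rel tensor_kernel_subset[OF M N tensor_kernel_rel] by blast
  next
    case (uminus t)
    then show ?case
      using h_rel[OF uminus] tensor_kernel_subset[OF M N tensor_kernel_rel[OF uminus]] minus by simp
  next
    case (add s t)
    then show ?case
      using h_add[of s t] by (simp add: order_trans[OF Poly_Mapping.keys_add])
  qed
  from this[OF xy(3)] show ?thesis using xy by simp
qed

section \<open>Flat principal ideals\<close>

lemma ideal_module_simps [simp]:
  "carrier (ideal_module R J) = J"
  "\<zero>\<^bsub>ideal_module R J\<^esub> = \<zero>\<^bsub>R\<^esub>"
  "x \<oplus>\<^bsub>ideal_module R J\<^esub> y = x \<oplus>\<^bsub>R\<^esub> y"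
  "a \<odot>\<^bsub>ideal_module R J\<^esub> x = a \<otimes>\<^bsub>R\<^esub> x"
  by (simp_all add: ideal_module_def)

lemma module_ideal_module:
  assumes "cring R" "ideal J R"
  shows "module R (ideal_module R J)"
proof -
  interpret cring R by fact
  interpret ideal J R by fact
  have "abelian_group (ideal_module R J)"
  proof (rule abelian_groupI)
    fix x assume "x \<in> carrier (ideal_module R J)"
    then show "\<exists>y\<in>carrier (ideal_module R J). y \<oplus>\<^bsub>ideal_module R J\<^esub> x = \<zero>\<^bsub>ideal_module R J\<^esub>"
      by (intro bexI[of _ "\<ominus>\<^bsub>R\<^esub> x"]) (auto simp: l_neg)
  qed (auto simp: a_ac)
  then show ?thesis
    by (intro moduleI is_cring) (auto simp: I_l_closed l_distr r_distr m_assoc)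
qed

text \<open>Flatness is tested on the inclusion of \<open>R b\<close> into \<open>R\<close>, which sends the tensor of \<open>a\<close> and \<open>b\<close> to
  that of \<open>b \<otimes> a = \<zero>\<close> and \<open>\<one>\<close>. To exploit that the tensor of \<open>a\<close> and \<open>b\<close> vanishes, multiply the
  quotient of the left factor by \<open>a\<close> with the right factor. This is well defined modulo \<open>b \<otimes> ann a\<close>, and
  it shows that \<open>b\<close> belongs to that ideal.\<close>

lemma flat_principal_ideal_imp_pure_annihilator:
  fixes R (structure)
  assumes "cring R" and flat: "flat_module R (ideal_module R (PIdl a))"
    and a: "a \<in> carrier R" and b: "b \<in> carrier R" and ab: "a \<otimes> b = \<zero>"
  shows "\<exists>c\<in>carrier R. a \<otimes> c = \<zero> \<and> b \<otimes> c = b"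
proof -
  interpret cring R by fact
  let ?M = "ideal_module R (PIdl a)" and ?N = "ideal_module R (PIdl b)"
    and ?L = "ideal_module R (carrier R)"
  have M: "module R ?M" and N: "module R ?N" and L: "module R ?L"
    using cgenideal_ideal a b oneideal by (auto intro!: module_ideal_module is_cring)
  have a_in: "a \<in> carrier ?M" and b_in: "b \<in> carrier ?N"
    using a b cgenideal_self by auto
  have incl: "(\<lambda>y. y) \<in> module_hom R ?N ?L"
    using b by (auto simp: module_hom_def cgenideal_def)
  have "frag_of (b \<odot>\<^bsub>?M\<^esub> a, \<one>) - frag_of (a, b \<odot>\<^bsub>?L\<^esub> \<one>) \<in> tensor_kernel R ?M ?L"
    using a_in b by (intro tensor_kernel_rel tensor_relationsI) auto
  then have "frag_of (\<zero>, \<one>) - frag_of (a, b) \<in> tensor_kernel R ?M ?L"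
    using ab a b by (simp add: m_comm)
  moreover have "frag_of (\<zero>, \<one>) \<in> tensor_kernel R ?M ?L"
    using frag_of_zero_left_in_tensor_kernel[OF M L, of \<one>] by simp
  ultimately have "tensor_lift (\<lambda>y. y) (frag_of (a, b)) \<in> tensor_kernel R ?M ?L"
    using tensor_kernel_diff[OF M L, of "frag_of (\<zero>, \<one>)" "frag_of (\<zero>, \<one>) - frag_of (a, b)"] by simp
  moreover have "inj_on (tensor_map R ?M ?N ?L (\<lambda>y. y)) (carrier (tensor_product R ?M ?N))"
    by (rule flat_moduleD[OF flat N L incl]) simp
  moreover have "Poly_Mapping.keys (frag_of (a, b)) \<subseteq> carrier ?M \<times> carrier ?N"
    using a_in b_in by (simp add: keys_frag_of)
  ultimately have ker: "frag_of (a, b) \<in> tensor_kernel R ?M ?N"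
    unfolding inj_on_tensor_map_iff[OF M N L incl] by blast
  \<comment> \<open>The ideal \<open>b \<otimes> ann a\<close>.\<close>
  define J where "J = {b \<otimes> c | c. c \<in> carrier R \<and> a \<otimes> c = \<zero>}"
  have "ideal J R"
  proof (rule idealI[OF ring_axioms])
    show "subgroup J (add_monoid R)"
    proof
      show "J \<subseteq> carrier (add_monoid R)" using b by (auto simp: J_def)
      show "\<one>\<^bsub>add_monoid R\<^esub> \<in> J" using a b by (auto simp: J_def intro!: exI[of _ \<zero>])
    next
      fix x y assume "x \<in> J" "y \<in> J"
      then obtain c d where "x = b \<otimes> c" "y = b \<otimes> d" "c \<in> carrier R" "d \<in> carrier R"
        "a \<otimes> c = \<zero>" "a \<otimes> d = \<zero>" by (auto simp: J_def)
      then show "x \<otimes>\<^bsub>add_monoid R\<^esub> y \<in> J"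
        using a b by (auto simp: J_def r_distr intro!: exI[of _ "c \<oplus> d"])
    next
      fix x assume "x \<in> J"
      then obtain c where "x = b \<otimes> c" "c \<in> carrier R" "a \<otimes> c = \<zero>" by (auto simp: J_def)
      then show "inv\<^bsub>add_monoid R\<^esub> x \<in> J"
        using a b by (auto simp: J_def r_minus a_inv_def[symmetric] intro!: exI[of _ "\<ominus> c"])
    qed
  next
    fix x r assume "x \<in> J" and r: "r \<in> carrier R"
    then obtain c where c: "x = b \<otimes> c" "c \<in> carrier R" "a \<otimes> c = \<zero>" by (auto simp: J_def)
    have "a \<otimes> (r \<otimes> c) = r \<otimes> (a \<otimes> c)" "r \<otimes> x = b \<otimes> (r \<otimes> c)"
      using a b c(1,2) r by (simp_all add: m_ac)
    then show "r \<otimes> x \<in> J"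
      using c r unfolding J_def by (intro CollectI exI[of _ "r \<otimes> c"]) simp
    then show "x \<otimes> r \<in> J" using c(1,2) b r by (simp add: m_comm)
  qed
  then interpret J: ideal J R .
  interpret Q: ring "R Quot J" by (rule J.quotient_is_ring)
  define q where "q u = (SOME x. x \<in> carrier R \<and> u = x \<otimes> a)" for u
  have q: "q u \<in> carrier R" "q u \<otimes> a = u" if "u \<in> PIdl a" for u
  proof -
    have "\<exists>x. x \<in> carrier R \<and> u = x \<otimes> a" using that by (auto simp: cgenideal_def)
    from someI_ex[OF this] show "q u \<in> carrier R" "q u \<otimes> a = u" unfolding q_def by simp_all
  qed
  \<comment> \<open>The quotient of \<open>u\<close> by \<open>a\<close> is unique only up to the annihilator of \<open>a\<close>,
    whose product with \<open>v\<close> lies in \<open>J\<close>.\<close>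
  have indep: "J +> (x \<otimes> v) = J +> (q u \<otimes> v)"
    if x: "x \<in> carrier R" and u: "u = x \<otimes> a" "u \<in> PIdl a" and v: "v \<in> PIdl b" for x u v
  proof -
    obtain y where y: "y \<in> carrier R" "v = y \<otimes> b" using v by (auto simp: cgenideal_def)
    let ?d = "x \<ominus> q u"
    have d: "?d \<in> carrier R" using x q(1)[OF u(2)] by simp
    have "a \<otimes> ?d = x \<otimes> a \<ominus> q u \<otimes> a"
      using x q(1)[OF u(2)] a by (simp add: minus_eq r_distr r_minus m_comm)
    also have "\<dots> = \<zero>" using q(2)[OF u(2)] x a by (simp add: u(1) minus_eq r_neg)
    finally have "b \<otimes> ?d \<in> J" using d unfolding J_def by blast
    then have "y \<otimes> (b \<otimes> ?d) \<in> J" using y by (simp add: J.I_l_closed)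
    also have "y \<otimes> (b \<otimes> ?d) = x \<otimes> v \<ominus> q u \<otimes> v"
      using x y b q(1)[OF u(2)] by (simp add: minus_eq r_distr l_minus r_minus m_ac)
    finally show ?thesis
      using x y b q(1)[OF u(2)] by (subst quotient_eq_iff_same_a_r_cos[OF J.is_ideal, symmetric]) auto
  qed
  have PI: "PIdl a \<subseteq> carrier R" "PIdl b \<subseteq> carrier R" using a b by (auto simp: cgenideal_def)
  have cl: "J +> x \<in> carrier (R Quot J)" if "x \<in> carrier R" for x
    using J.rcos_ring_hom that by (auto simp: ring_hom_def)
  have plus: "(J +> x) \<oplus>\<^bsub>R Quot J\<^esub> (J +> y) = J +> (x \<oplus> y)"
    if "x \<in> carrier R" "y \<in> carrier R" for x y
    using J.rcos_ring_hom that by (auto simp: ring_hom_def)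
  have "J +> (q a \<otimes> b) = \<zero>\<^bsub>R Quot J\<^esub>"
  proof (rule balanced_map_kills_tensor_kernel[OF M N Q.abelian_group_axioms _ _ _ _ a_in b_in ker,
        of "\<lambda>u v. J +> (q u \<otimes> v)"])
    fix u v assume "u \<in> carrier ?M" "v \<in> carrier ?N"
    then show "J +> (q u \<otimes> v) \<in> carrier (R Quot J)" using q(1) PI by (intro cl) auto
  next
    fix u u' v assume uv: "u \<in> carrier ?M" "u' \<in> carrier ?M" "v \<in> carrier ?N"
    then have *: "u \<in> PIdl a" "u' \<in> PIdl a" "v \<in> PIdl b" by auto
    have "u \<oplus> u' = (q u \<oplus> q u') \<otimes> a"
      using q[OF *(1)] q[OF *(2)] a by (simp add: l_distr)
    moreover have "u \<oplus> u' \<in> PIdl a" using module.axioms(2)[OF M] uv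
      by (metis ideal_module_simps(1,3) abelian_group.axioms(1) abelian_monoid.a_closed)
    ultimately have "J +> ((q u \<oplus> q u') \<otimes> v) = J +> (q (u \<oplus> u') \<otimes> v)"
      using q(1)[OF *(1)] q(1)[OF *(2)] * by (intro indep) auto
    moreover have "v \<in> carrier R" using * PI by auto
    ultimately show "J +> (q (u \<oplus>\<^bsub>?M\<^esub> u') \<otimes> v) = (J +> (q u \<otimes> v)) \<oplus>\<^bsub>R Quot J\<^esub> (J +> (q u' \<otimes> v))"
      using q(1)[OF *(1)] q(1)[OF *(2)] by (simp add: plus l_distr)
  next
    fix u v v' assume "u \<in> carrier ?M" "v \<in> carrier ?N" "v' \<in> carrier ?N"
    then show "J +> (q u \<otimes> (v \<oplus>\<^bsub>?N\<^esub> v')) = (J +> (q u \<otimes> v)) \<oplus>\<^bsub>R Quot J\<^esub> (J +> (q u \<otimes> v'))"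
      using q(1)[of u] PI by (simp add: plus r_distr subset_iff)
  next
    fix r u v assume "r \<in> carrier R" "u \<in> carrier ?M" "v \<in> carrier ?N"
    then have *: "r \<in> carrier R" "u \<in> PIdl a" "v \<in> PIdl b" "v \<in> carrier R" using PI by auto
    have "r \<otimes> u = (r \<otimes> q u) \<otimes> a" using q[OF *(2)] * a by (simp add: m_assoc)
    moreover have "r \<otimes> u \<in> PIdl a" using ideal.I_l_closed[OF cgenideal_ideal[OF a]] * by blast
    ultimately have "J +> ((r \<otimes> q u) \<otimes> v) = J +> (q (r \<otimes> u) \<otimes> v)"
      using q(1)[OF *(2)] * by (intro indep) auto
    then show "J +> (q (r \<odot>\<^bsub>?M\<^esub> u) \<otimes> v) = J +> (q u \<otimes> (r \<odot>\<^bsub>?N\<^esub> v))"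
      using q(1)[OF *(2)] * by (simp add: m_ac)
  qed
  moreover have "J +> (\<one> \<otimes> b) = J +> (q a \<otimes> b)"
    using a_in b_in a by (intro indep) auto
  ultimately have "J +> b = J" using b by (simp add: FactRing_def)
  then have "b \<in> J" using b J.rcos_const_imp_mem by blast
  then obtain c where "c \<in> carrier R" "b = b \<otimes> c" "a \<otimes> c = \<zero>" unfolding J_def by blast
  then show ?thesis by (intro bexI[of _ c]) simp_all
qed

text \<open>Scalars move across the tensor sign, so every element of the tensor product of \<open>R a\<close> with \<open>N\<close> is
  the class of a single \<open>frag_of (a, y)\<close>. Testing injectivity thus reduces to such generators.\<close>

lemma principal_tensor_is_pure:
  fixes R (structure)
  assumes "cring R" and a: "a \<in> carrier R" and N: "module R N"
    and t: "Poly_Mapping.keys t \<subseteq> (PIdl a) \<times> carrier N"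
  shows "\<exists>y\<in>carrier N. t - frag_of (a, y) \<in> tensor_kernel R (ideal_module R (PIdl a)) N"
proof -
  interpret cring R by fact
  interpret N: module R N by fact
  let ?M = "ideal_module R (PIdl a)"
  have M: "module R ?M" using a cgenideal_ideal by (auto intro!: module_ideal_module is_cring)
  have a_in: "a \<in> carrier ?M" using a cgenideal_self by auto
  show ?thesis using t
  proof (induction t rule: frag_induction)
    case zero
    have "0 - frag_of (a, \<zero>\<^bsub>N\<^esub>) \<in> tensor_kernel R ?M N"
      by (intro tensor_kernel_diff[OF M N] tensor_kernel_zero
          frag_of_zero_right_in_tensor_kernel[OF M N a_in])
    then show ?case by blast
  next
    case (one p)
    then obtain x y where p: "p = (x \<otimes> a, y)" "x \<in> carrier R" "y \<in> carrier N"
      by (auto simp: cgenideal_def)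
    have "frag_of (x \<odot>\<^bsub>?M\<^esub> a, y) - frag_of (a, x \<odot>\<^bsub>N\<^esub> y) \<in> tensor_kernel R ?M N"
      using p a_in by (intro tensor_kernel_rel tensor_relationsI)
    then show ?case using p by (intro bexI[of _ "x \<odot>\<^bsub>N\<^esub> y"]) auto
  next
    case (diff s t)
    then obtain y z where y: "y \<in> carrier N" "s - frag_of (a, y) \<in> tensor_kernel R ?M N"
      and z: "z \<in> carrier N" "t - frag_of (a, z) \<in> tensor_kernel R ?M N" by blast
    let ?d = "y \<ominus>\<^bsub>N\<^esub> z"
    have "frag_of (a, ?d \<oplus>\<^bsub>N\<^esub> z) - (frag_of (a, ?d) + frag_of (a, z)) \<in> tensor_kernel R ?M N"
      using y z a_in by (intro tensor_kernel_rel tensor_relationsI) auto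
    moreover have "?d \<oplus>\<^bsub>N\<^esub> z = y" using y z by (simp add: N.M.minus_eq N.M.a_assoc N.M.l_neg)
    ultimately have "(s - frag_of (a, y)) - (t - frag_of (a, z)) +
        (frag_of (a, y) - (frag_of (a, ?d) + frag_of (a, z))) \<in> tensor_kernel R ?M N"
      using tensor_kernel_add tensor_kernel_diff[OF M N] y(2) z(2) by metis
    then have "s - t - frag_of (a, ?d) \<in> tensor_kernel R ?M N" by (simp add: algebra_simps)
    then show ?case using y z by blast
  qed
qed

text \<open>The hypotheses say that \<open>a \<otimes> x \<mapsto> e \<otimes> x\<close> is a well-defined linear map from \<open>R a\<close> to \<open>R\<close> with
  left inverse multiplication by \<open>a\<close>, so \<open>R a\<close> is projective. Concretely, if the tensor of \<open>a\<close> and \<open>f y\<close>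
  vanishes, this map gives \<open>f (e \<odot> y) = \<zero>\<close>, whence \<open>e \<odot> y = \<zero>\<close> by injectivity; and the tensor of \<open>a\<close> and
  \<open>y\<close> equals that of \<open>a\<close> and \<open>e \<odot> y\<close> because \<open>a = a \<otimes> e\<close>.\<close>

lemma flat_principal_idealI:
  fixes R (structure)
  assumes "cring R" and a: "a \<in> carrier R" and e: "e \<in> carrier R" and ae: "a \<otimes> e = a"
    and ann: "\<And>x. x \<in> carrier R \<Longrightarrow> a \<otimes> x = \<zero> \<Longrightarrow> e \<otimes> x = \<zero>"
  shows "flat_module R (ideal_module R (PIdl a))"
proof -
  interpret cring R by fact
  let ?M = "ideal_module R (PIdl a)"
  have M: "module R ?M" using a cgenideal_ideal by (auto intro!: module_ideal_module is_cring)
  have a_in: "a \<in> carrier ?M" using a cgenideal_self by auto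
  \<comment> \<open>The linear section \<open>a \<otimes> x \<mapsto> e \<otimes> x\<close> of multiplication by \<open>a\<close>.\<close>
  define s where "s u = e \<otimes> (SOME x. x \<in> carrier R \<and> u = x \<otimes> a)" for u
  have s: "s (x \<otimes> a) = e \<otimes> x" if x: "x \<in> carrier R" for x
  proof -
    let ?y = "SOME y. y \<in> carrier R \<and> x \<otimes> a = y \<otimes> a"
    have y: "?y \<in> carrier R" "x \<otimes> a = ?y \<otimes> a"
      using someI[of "\<lambda>y. y \<in> carrier R \<and> x \<otimes> a = y \<otimes> a" x] x by auto
    have "a \<otimes> (x \<ominus> ?y) = x \<otimes> a \<ominus> ?y \<otimes> a"
      using x y(1) a by (simp add: minus_eq r_distr r_minus m_comm)
    also have "\<dots> = \<zero>" unfolding y(2)[symmetric] using x a by (simp add: minus_eq r_neg)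
    finally have "e \<otimes> (x \<ominus> ?y) = \<zero>" using x y(1) by (intro ann) auto
    then have "e \<otimes> x \<ominus> e \<otimes> ?y = \<zero>"
      using e x y(1) by (simp add: minus_eq r_distr r_minus)
    then have "e \<otimes> x = e \<otimes> ?y" using e x y(1) by simp
    then show ?thesis by (simp add: s_def)
  qed
  have "inj_on (tensor_map R ?M N N' f) (carrier (tensor_product R ?M N))"
    if N: "module R N" and N': "module R N'" and f: "f \<in> module_hom R N N'"
      and inj: "inj_on f (carrier N)"
    for N N' :: "('a, (nat \<Rightarrow> 'a) set) module" and f
    unfolding inj_on_tensor_map_iff[OF M N N' f]
  proof (intro allI impI)
    interpret N: module R N by fact
    interpret N': module R N' by fact
    note fD = module_homD[OF f]
    fix t assume t: "Poly_Mapping.keys t \<subseteq> carrier ?M \<times> carrier N"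
      and ft: "tensor_lift f t \<in> tensor_kernel R ?M N'"
    obtain y where y: "y \<in> carrier N" "t - frag_of (a, y) \<in> tensor_kernel R ?M N"
      using principal_tensor_is_pure[OF is_cring a N] t by auto
    have "tensor_lift f t - tensor_lift f (t - frag_of (a, y)) \<in> tensor_kernel R ?M N'"
      by (intro tensor_kernel_diff[OF M N'] ft tensor_kernel_lift[OF M N N' f] y(2))
    then have ker: "frag_of (a, f y) \<in> tensor_kernel R ?M N'" by simp
    have "s a \<odot>\<^bsub>N'\<^esub> f y = \<zero>\<^bsub>N'\<^esub>"
    proof (rule balanced_map_kills_tensor_kernel[OF M N' N'.abelian_group_axioms _ _ _ _ a_in _ ker,
          of "\<lambda>u v. s u \<odot>\<^bsub>N'\<^esub> v"])
      fix u v assume "u \<in> carrier ?M" "v \<in> carrier N'"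
      then show "s u \<odot>\<^bsub>N'\<^esub> v \<in> carrier N'"
        using s e by (auto simp: cgenideal_def)
    next
      fix u u' v assume "u \<in> carrier ?M" "u' \<in> carrier ?M" and v: "v \<in> carrier N'"
      then obtain x x' where x: "u = x \<otimes> a" "x \<in> carrier R" "u' = x' \<otimes> a" "x' \<in> carrier R"
        by (auto simp: cgenideal_def)
      have "u \<oplus> u' = (x \<oplus> x') \<otimes> a" using x a by (simp add: l_distr)
      then show "s (u \<oplus>\<^bsub>?M\<^esub> u') \<odot>\<^bsub>N'\<^esub> v = s u \<odot>\<^bsub>N'\<^esub> v \<oplus>\<^bsub>N'\<^esub> s u' \<odot>\<^bsub>N'\<^esub> v"
        using x v e s by (simp add: r_distr N'.smult_l_distr)
    next
      fix u v v' assume "u \<in> carrier ?M" "v \<in> carrier N'" "v' \<in> carrier N'"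
      then show "s u \<odot>\<^bsub>N'\<^esub> (v \<oplus>\<^bsub>N'\<^esub> v') = s u \<odot>\<^bsub>N'\<^esub> v \<oplus>\<^bsub>N'\<^esub> s u \<odot>\<^bsub>N'\<^esub> v'"
        using s e by (auto simp: cgenideal_def N'.smult_r_distr)
    next
      fix r u v assume "u \<in> carrier ?M" and r: "r \<in> carrier R" and v: "v \<in> carrier N'"
      then obtain x where x: "u = x \<otimes> a" "x \<in> carrier R" by (auto simp: cgenideal_def)
      have "r \<otimes> u = (r \<otimes> x) \<otimes> a" using x a r by (simp add: m_assoc)
      then have "s (r \<otimes> u) = s u \<otimes> r" using x r e s by (simp add: m_ac)
      then show "s (r \<odot>\<^bsub>?M\<^esub> u) \<odot>\<^bsub>N'\<^esub> v = s u \<odot>\<^bsub>N'\<^esub> (r \<odot>\<^bsub>N'\<^esub> v)"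
        using x r v e s by (simp add: N'.smult_assoc1)
    qed (use fD(1) y(1) in auto)
    moreover have "s a = e" using s[of \<one>] a e by simp
    ultimately have "f (e \<odot>\<^bsub>N\<^esub> y) = f \<zero>\<^bsub>N\<^esub>"
      using fD(3)[of \<zero> "\<zero>\<^bsub>N\<^esub>"] fD(1)[of "\<zero>\<^bsub>N\<^esub>"] fD(3)[OF e y(1)] by simp
    then have ey: "e \<odot>\<^bsub>N\<^esub> y = \<zero>\<^bsub>N\<^esub>" using inj_onD[OF inj] e y(1) by simp
    have "frag_of (e \<odot>\<^bsub>?M\<^esub> a, y) - frag_of (a, e \<odot>\<^bsub>N\<^esub> y) \<in> tensor_kernel R ?M N"
      using e y(1) a_in by (intro tensor_kernel_rel tensor_relationsI) auto
    moreover have "frag_of (a, e \<odot>\<^bsub>N\<^esub> y) \<in> tensor_kernel R ?M N"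
      unfolding ey by (rule frag_of_zero_right_in_tensor_kernel[OF M N a_in])
    ultimately have "(frag_of (a, y) - frag_of (a, e \<odot>\<^bsub>N\<^esub> y)) + frag_of (a, e \<odot>\<^bsub>N\<^esub> y) \<in> tensor_kernel R ?M N"
      using ae a e by (intro tensor_kernel_add) (simp_all add: m_comm)
    then have "(t - frag_of (a, y)) + frag_of (a, y) \<in> tensor_kernel R ?M N"
      using y(2) by (intro tensor_kernel_add) simp_all
    then show "t \<in> tensor_kernel R ?M N" by simp
  qed
  then show ?thesis using M by (simp add: flat_module_def)
qed

section \<open>PF-rings\<close>

lemma PF_ringI:
  fixes R (structure)
  assumes "cring R"
    and "\<And>a. a \<in> carrier R \<Longrightarrow> \<exists>e\<in>carrier R. a \<otimes> e = a \<and>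
      (\<forall>x\<in>carrier R. a \<otimes> x = \<zero> \<longrightarrow> e \<otimes> x = \<zero>)"
  shows "PF_ring R"
  unfolding PF_ring_def using assms flat_principal_idealI[OF assms(1)] by metis

lemma domain_imp_PF_ring:
  fixes R (structure)
  assumes "domain R"
  shows "PF_ring R"
proof -
  interpret domain R by fact
  show ?thesis
  proof (rule PF_ringI[OF is_cring])
    fix a assume a: "a \<in> carrier R"
    show "\<exists>e\<in>carrier R. a \<otimes> e = a \<and> (\<forall>x\<in>carrier R. a \<otimes> x = \<zero> \<longrightarrow> e \<otimes> x = \<zero>)"
    proof (cases "a = \<zero>")
      case True
      then show ?thesis by (intro bexI[of _ \<zero>]) auto
    next
      case False
      then show ?thesis using a by (intro bexI[of _ \<one>]) (auto simp: integral_iff)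
    qed
  qed
qed

lemma von_Neumann_regular_imp_PF_ring:
  fixes R (structure)
  assumes "cring R" and "\<And>a. a \<in> carrier R \<Longrightarrow> \<exists>x\<in>carrier R. a \<otimes> a \<otimes> x = a"
  shows "PF_ring R"
proof (rule PF_ringI[OF assms(1)])
  interpret cring R by fact
  fix a assume a: "a \<in> carrier R"
  then obtain x where x: "x \<in> carrier R" "a \<otimes> a \<otimes> x = a" using assms(2) by blast
  have "a \<otimes> (a \<otimes> x) = a" using a x by (simp add: m_assoc)
  moreover have "(a \<otimes> x) \<otimes> y = \<zero>" if "y \<in> carrier R" "a \<otimes> y = \<zero>" for y
  proof -
    have "(a \<otimes> x) \<otimes> y = x \<otimes> (a \<otimes> y)" using a x(1) that(1) by (simp add: m_ac)
    then show ?thesis using x(1) that(2) by simp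
  qed
  ultimately show "\<exists>e\<in>carrier R. a \<otimes> e = a \<and> (\<forall>y\<in>carrier R. a \<otimes> y = \<zero> \<longrightarrow> e \<otimes> y = \<zero>)"
    using a x(1) by blast
qed

lemma (in ideal) quotient_eq_zero_iff:
  assumes "x \<in> carrier R"
  shows "I +> x = \<zero>\<^bsub>R Quot I\<^esub> \<longleftrightarrow> x \<in> I"
  using assms rcos_const_imp_mem a_rcos_zero[OF is_ideal] by (auto simp: FactRing_def)

lemma (in ideal) carrier_quotient:
  "carrier (R Quot I) = (+>) I ` carrier R"
  by (auto simp: FactRing_def A_RCOSETS_def')

lemma PF_quotient_pure_annihilator:
  fixes R (structure)
  assumes "ideal I R" "PF_ring (R Quot I)"
    and a: "a \<in> carrier R" and b: "b \<in> carrier R" and ab: "a \<otimes> b \<in> I"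
  shows "\<exists>c\<in>carrier R. a \<otimes> c \<in> I \<and> b \<ominus> b \<otimes> c \<in> I"
proof -
  interpret ideal I R by fact
  interpret Q: cring "R Quot I" using assms(2) by (simp add: PF_ring_def)
  interpret h: ring_hom_ring R "R Quot I" "(+>) I" by (rule rcos_ring_hom_ring)
  have flat: "flat_module (R Quot I) (ideal_module (R Quot I) (PIdl\<^bsub>R Quot I\<^esub> (I +> a)))"
    using assms(2) a h.hom_closed unfolding PF_ring_def by blast
  have "(I +> a) \<otimes>\<^bsub>R Quot I\<^esub> (I +> b) = \<zero>\<^bsub>R Quot I\<^esub>"
    using a b ab quotient_eq_zero_iff[of "a \<otimes> b"] by simp
  from flat_principal_ideal_imp_pure_annihilator[OF Q.is_cring flat h.hom_closed[OF a] h.hom_closed[OF b] this]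
  obtain c where c: "c \<in> carrier R" "(I +> a) \<otimes>\<^bsub>R Quot I\<^esub> (I +> c) = \<zero>\<^bsub>R Quot I\<^esub>"
    "(I +> b) \<otimes>\<^bsub>R Quot I\<^esub> (I +> c) = I +> b"
    unfolding carrier_quotient by blast
  have "a \<otimes> c \<in> I" using c a quotient_eq_zero_iff[of "a \<otimes> c"] by simp
  moreover have "I +> b = I +> (b \<otimes> c)" using c b by simp
  then have "b \<ominus> b \<otimes> c \<in> I"
    using b c(1) quotient_eq_iff_same_a_r_cos[OF is_ideal, of b "b \<otimes> c"] by simp
  ultimately show ?thesis using c(1) by blast
qed

text \<open>Purity for \<open>b = a\<close>: then \<open>a = a \<otimes> c\<close> modulo \<open>I\<close>, while \<open>a \<otimes> c\<close> lies in \<open>I\<close>.\<close>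

lemma PF_quotient_imp_radical:
  fixes R (structure)
  assumes "ideal I R" "PF_ring (R Quot I)" and a: "a \<in> carrier R" and aa: "a \<otimes> a \<in> I"
  shows "a \<in> I"
proof -
  interpret ideal I R by fact
  obtain c where c: "c \<in> carrier R" "a \<otimes> c \<in> I" "a \<ominus> a \<otimes> c \<in> I"
    using PF_quotient_pure_annihilator[OF assms(1,2) a a aa] by blast
  then have "(a \<ominus> a \<otimes> c) \<oplus> a \<otimes> c \<in> I" by simp
  then show ?thesis using a c(1) by (simp add: minus_eq a_assoc l_neg)
qed

lemma (in primeideal) primeideal_imp_primary_ideal: "primary_ideal I R"
  unfolding primary_ideal_def
proof (intro conjI ballI impI)
  fix a b assume ab: "a \<in> carrier R" "b \<in> carrier R" "a \<otimes> b \<in> I"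
  then have "a \<in> I \<or> b [^] (1::nat) \<in> I" using I_prime by simp
  then show "a \<in> I \<or> (\<exists>n::nat. n > 0 \<and> b [^] n \<in> I)" by (metis zero_less_one)
qed (use is_ideal I_notcarr in auto)

text \<open>The element \<open>c\<close> supplied by purity acts on \<open>b\<close> as the identity modulo \<open>I\<close>, and so do its powers,
  one of which lies in \<open>I\<close> because \<open>I\<close> is primary.\<close>

lemma primary_PF_quotient_imp_prime:
  fixes R (structure)
  assumes "cring R" "primary_ideal I R" "PF_ring (R Quot I)"
  shows "primeideal I R"
proof (rule primeidealI)
  show I: "ideal I R" and "carrier R \<noteq> I" using assms(2) by (auto simp: primary_ideal_def)
  show "cring R" by fact
  interpret cring R by fact
  interpret ideal I R by fact
  fix a b assume a: "a \<in> carrier R" and b: "b \<in> carrier R" and ab: "a \<otimes> b \<in> I"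
  show "a \<in> I \<or> b \<in> I"
  proof (cases "a \<in> I")
    case False
    obtain c where c: "c \<in> carrier R" "a \<otimes> c \<in> I" "b \<ominus> b \<otimes> c \<in> I"
      using PF_quotient_pure_annihilator[OF I assms(3) a b ab] by blast
    obtain n :: nat where n: "c [^] n \<in> I"
      using assms(2) a c False unfolding primary_ideal_def by blast
    have "b \<ominus> b \<otimes> c [^] k \<in> I" for k :: nat
    proof (induction k)
      case 0
      then show ?case using b by (simp add: minus_eq r_neg)
    next
      case (Suc k)
      have expand: "(b \<ominus> b \<otimes> c) \<oplus> (b \<ominus> b \<otimes> d) \<otimes> c = b \<ominus> b \<otimes> (d \<otimes> c)" if "d \<in> carrier R" for d
        using b c(1) that by algebra
      have "(b \<ominus> b \<otimes> c) \<oplus> (b \<ominus> b \<otimes> c [^] k) \<otimes> c \<in> I"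
        using Suc c by (simp add: I_r_closed)
      also have "(b \<ominus> b \<otimes> c) \<oplus> (b \<ominus> b \<otimes> c [^] k) \<otimes> c = b \<ominus> b \<otimes> c [^] Suc k"
        using expand[of "c [^] k"] c(1) by simp
      finally show ?case .
    qed
    then have "(b \<ominus> b \<otimes> c [^] n) \<oplus> b \<otimes> c [^] n \<in> I" using n b by (simp add: I_l_closed)
    then have "b \<in> I" using b c(1) by (simp add: minus_eq a_assoc l_neg)
    then show ?thesis ..
  qed simp
qed

section \<open>Products of ideals\<close>

lemma ideals_set_simps [simp]:
  "carrier (ideals_set R) = {J. ideal J R}"
  "J \<otimes>\<^bsub>ideals_set R\<^esub> K = ideal_prod R J K"
  "\<one>\<^bsub>ideals_set R\<^esub> = carrier R"
  by (simp_all add: ideals_set_def)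

lemma (in cring) finprod_ideals_factor:
  assumes "finite A" "i \<in> A" "Q \<in> A \<rightarrow> {J. ideal J R}"
  shows "finprod (ideals_set R) Q A = Q i \<cdot> finprod (ideals_set R) Q (A - {i})"
proof -
  interpret S: comm_monoid "ideals_set R" by (rule ideals_set_is_comm_monoid)
  have "finprod (ideals_set R) Q (insert i (A - {i})) =
      Q i \<otimes>\<^bsub>ideals_set R\<^esub> finprod (ideals_set R) Q (A - {i})"
    by (rule S.finprod_insert) (use assms in auto)
  then show ?thesis using assms(2) by (simp add: insert_absorb)
qed

lemma (in cring) finprod_ideals_ideal:
  assumes "Q \<in> A \<rightarrow> {J. ideal J R}"
  shows "ideal (finprod (ideals_set R) Q A) R"
  using comm_monoid.finprod_closed[OF ideals_set_is_comm_monoid, of Q A] assms by simp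

lemma (in cring) finprod_ideals_subset:
  assumes "finite A" "i \<in> A" "Q \<in> A \<rightarrow> {J. ideal J R}"
  shows "finprod (ideals_set R) Q A \<subseteq> Q i"
  unfolding finprod_ideals_factor[OF assms]
  using ideal_prod_inter[of "Q i" "finprod (ideals_set R) Q (A - {i})"]
    finprod_ideals_ideal[of Q "A - {i}"] assms by blast

lemma (in primeideal) finprod_ideals_subset_imp:
  assumes "finite A" "Q \<in> A \<rightarrow> {J. ideal J R}" "finprod (ideals_set R) Q A \<subseteq> I"
  shows "\<exists>i\<in>A. Q i \<subseteq> I"
  using assms
proof (induction A rule: finite_induct)
  case empty
  interpret S: comm_monoid "ideals_set R" by (rule ideals_set_is_comm_monoid)
  show ?case using empty.prems(2) I_notcarr a_subset by auto
next
  case (insert i A)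
  interpret S: comm_monoid "ideals_set R" by (rule ideals_set_is_comm_monoid)
  let ?K = "finprod (ideals_set R) Q A"
  have Q: "ideal (Q i) R" "Q \<in> A \<rightarrow> {J. ideal J R}" using insert.prems(1) by auto
  have K: "ideal ?K R" by (rule finprod_ideals_ideal[OF Q(2)])
  have prod: "Q i \<cdot> ?K \<subseteq> I"
    using insert.prems(2) insert.hyps Q by simp
  show ?case
  proof (cases "Q i \<subseteq> I")
    case False
    then obtain x where x: "x \<in> Q i" "x \<notin> I" by blast
    have "?K \<subseteq> I"
    proof
      fix y assume y: "y \<in> ?K"
      then have "x \<otimes> y \<in> I" using prod ideal_prod.prod[OF x(1) y, of R] by blast
      then show "y \<in> I" using I_prime x y ideal.Icarr[OF Q(1)] ideal.Icarr[OF K] by blast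
    qed
    then show ?thesis using insert.IH Q(2) by blast
  qed auto
qed

text \<open>A maximal ideal that contains a product of maximal ideals is one of the factors. Hence each new
  factor is comaximal with the product of the previous ones, and for comaximal ideals the product is
  the intersection.\<close>

lemma (in cring) finprod_distinct_maximal_ideals:
  assumes "finite A" "\<And>i. i \<in> A \<Longrightarrow> maximalideal (Q i) R" "inj_on Q A"
  shows "finprod (ideals_set R) Q A = {x \<in> carrier R. \<forall>i\<in>A. x \<in> Q i}"
  using assms
proof (induction A rule: finite_induct)
  case empty
  interpret S: comm_monoid "ideals_set R" by (rule ideals_set_is_comm_monoid)
  show ?case by simp
next
  case (insert i A)
  interpret S: comm_monoid "ideals_set R" by (rule ideals_set_is_comm_monoid)
  let ?K = "finprod (ideals_set R) Q A"
  have max: "maximalideal (Q j) R" if "j \<in> insert i A" for j using insert.prems(1) that .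
  have id: "ideal (Q j) R" if "j \<in> insert i A" for j using max[OF that] maximalideal.axioms(1) by blast
  have QA: "Q \<in> A \<rightarrow> {J. ideal J R}" using id by auto
  have K: "ideal ?K R" by (rule finprod_ideals_ideal[OF QA])
  interpret Mi: maximalideal "Q i" R by (rule max) simp
  interpret Pi: primeideal "Q i" R by (rule maximalideal_prime[OF Mi.is_maximalideal])
  have sum_ideal: "ideal (Q i <+> ?K) R" by (rule add_ideals[OF Mi.is_ideal K])
  have sub: "Q i \<union> ?K \<subseteq> Q i <+> ?K"
    unfolding union_genideal[OF Mi.is_ideal K, symmetric]
    using Mi.a_subset ideal.Icarr[OF K] by (intro genideal_self) blast
  have "Q i <+> ?K = carrier R"
  proof (rule ccontr)
    assume "Q i <+> ?K \<noteq> carrier R"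
    then have "Q i <+> ?K = Q i"
      using Mi.I_maximal[OF sum_ideal] sub ideal.Icarr[OF sum_ideal] by blast
    then have "?K \<subseteq> Q i" using sub by blast
    then obtain j where j: "j \<in> A" "Q j \<subseteq> Q i"
      using Pi.finprod_ideals_subset_imp[OF insert.hyps(1) QA] by blast
    then have "Q i = Q j"
      using maximalideal.I_maximal[OF max[of j] Mi.is_ideal] Mi.I_notcarr Mi.a_subset by blast
    then show False using j(1) insert.hyps(2) insert.prems(2) by (auto simp: inj_on_def)
  qed
  then have "Q i \<cdot> ?K = Q i \<inter> ?K" by (rule ideal_prod_eq_inter[OF Mi.is_ideal K])
  moreover have "?K = {x \<in> carrier R. \<forall>i\<in>A. x \<in> Q i}"
    using insert.IH insert.prems by (auto simp: inj_on_def)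
  moreover have "finprod (ideals_set R) Q (insert i A) = Q i \<cdot> ?K"
    using insert.hyps QA Mi.is_ideal by simp
  ultimately show ?case by auto
qed

lemma (in cring) Idl_insertE:
  assumes "g \<in> carrier R" "A \<subseteq> carrier R" "z \<in> Idl (insert g A)"
  obtains r y where "r \<in> carrier R" "y \<in> Idl A" "z = r \<otimes> g \<oplus> y"
proof -
  have id: "ideal (PIdl g) R" "ideal (Idl A) R"
    using assms cgenideal_ideal genideal_ideal by auto
  have "insert g A \<subseteq> PIdl g <+> Idl A"
    unfolding union_genideal[OF id, symmetric]
    using cgenideal_self[OF assms(1)] genideal_self[OF assms(2)]
      genideal_self[of "PIdl g \<union> Idl A"] ideal.Icarr[OF id(1)] ideal.Icarr[OF id(2)] by blast
  then have "Idl (insert g A) \<subseteq> PIdl g <+> Idl A"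
    by (intro genideal_minimal add_ideals id)
  then have "z \<in> PIdl g <+> Idl A" using assms(3) by blast
  then show ?thesis using that by (auto simp: set_add_def' cgenideal_def)
qed

text \<open>The generators of \<open>J\<close> are removed one at a time. If \<open>s \<otimes> J\<close> lies in the ideal generated by \<open>g\<close> and
  \<open>B\<close>, then \<open>g \<in> P \<cdot> J\<close> yields \<open>s \<otimes> g = p \<otimes> g \<oplus> y\<close> with \<open>p\<close> in \<open>P\<close> and \<open>y\<close> in the ideal generated by
  \<open>B\<close>. So \<open>s \<ominus> p\<close> carries \<open>g\<close> into that ideal, \<open>(s \<ominus> p) \<otimes> s\<close> carries \<open>J\<close> into it, and both stay
  congruent to \<open>\<one>\<close> modulo \<open>P\<close>.\<close>

lemma (in cring) Nakayama:
  assumes P: "ideal P R" and J: "ideal J R" and JP: "J \<subseteq> P \<cdot> J"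
    and A: "finite A" "J = Idl A" "A \<subseteq> carrier R"
  shows "\<exists>s\<in>carrier R. \<one> \<ominus> s \<in> P \<and> (\<forall>j\<in>J. s \<otimes> j = \<zero>)"
proof -
  interpret P: ideal P R by fact
  interpret J: ideal J R by fact
  have step: "\<exists>s'\<in>carrier R. \<one> \<ominus> s' \<in> P \<and> (\<forall>j\<in>J. s' \<otimes> j = \<zero>)"
    if "finite B" "B \<subseteq> J" "s \<in> carrier R" "\<one> \<ominus> s \<in> P" "\<forall>j\<in>J. s \<otimes> j \<in> Idl B" for B s
    using that
  proof (induction B arbitrary: s rule: finite_induct)
    case empty
    have "Idl {} \<subseteq> {\<zero>}" by (intro genideal_minimal zeroideal) simp
    then show ?case using empty by blast
  next
    case (insert g B)
    note s = insert.prems(2,3)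
    have g: "g \<in> carrier R" "g \<in> J" and B: "B \<subseteq> carrier R" using insert.prems(1) J.a_subset by auto
    interpret B: ideal "Idl B" R by (rule genideal_ideal[OF B])
    have split: "\<exists>r y. r \<in> carrier R \<and> y \<in> Idl B \<and> s \<otimes> j = r \<otimes> g \<oplus> y" if "j \<in> J" for j
      using Idl_insertE[OF g(1) B] insert.prems(4) that by metis
    have "\<exists>p\<in>P. \<exists>y\<in>Idl B. s \<otimes> z = p \<otimes> g \<oplus> y" if "z \<in> P \<cdot> J" for z
      using that
    proof (induction z rule: ideal_prod.induct)
      case (prod i j)
      then obtain r y where ry: "r \<in> carrier R" "y \<in> Idl B" "s \<otimes> j = r \<otimes> g \<oplus> y" using split by blast
      have car: "i \<in> carrier R" "j \<in> carrier R" "y \<in> carrier R" using prod ry by auto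
      have "s \<otimes> (i \<otimes> j) = i \<otimes> (s \<otimes> j)" using s car by (simp add: m_ac)
      also have "\<dots> = (i \<otimes> r) \<otimes> g \<oplus> i \<otimes> y" using ry(1) car g by (simp add: ry(3) r_distr m_assoc)
      finally show ?case using P.I_r_closed[OF prod(1) ry(1)] B.I_l_closed[OF ry(2) car(1)] by blast
    next
      case (sum z1 z2)
      then obtain p1 y1 p2 y2 where *: "p1 \<in> P" "y1 \<in> Idl B" "s \<otimes> z1 = p1 \<otimes> g \<oplus> y1"
        "p2 \<in> P" "y2 \<in> Idl B" "s \<otimes> z2 = p2 \<otimes> g \<oplus> y2" by blast
      have car: "z1 \<in> carrier R" "z2 \<in> carrier R"
        using sum.hyps ideal_prod_in_carrier[OF P J] by auto
      have "s \<otimes> (z1 \<oplus> z2) = (p1 \<otimes> g \<oplus> y1) \<oplus> (p2 \<otimes> g \<oplus> y2)"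
        using s(1) car by (simp add: r_distr *(3,6))
      also have "\<dots> = (p1 \<oplus> p2) \<otimes> g \<oplus> (y1 \<oplus> y2)" using * g by (simp add: l_distr a_ac)
      finally show ?case using * by (meson P.a_closed B.a_closed)
    qed
    then obtain p y where p: "p \<in> P" "y \<in> Idl B" "s \<otimes> g = p \<otimes> g \<oplus> y" using g(2) JP by blast
    have pc: "p \<in> carrier R" "y \<in> carrier R" using p by auto
    let ?t = "s \<ominus> p"
    have t: "?t \<in> carrier R" using s pc by simp
    have "?t \<otimes> g = y"
      using s(1) pc g p(3) by (simp add: minus_eq l_distr l_minus a_ac r_neg1 r_neg2) (simp add: a_assoc[symmetric] r_neg)
    have "?t \<otimes> s \<otimes> j \<in> Idl B" if j: "j \<in> J" for j
    proof -
      obtain r z where rz: "r \<in> carrier R" "z \<in> Idl B" "s \<otimes> j = r \<otimes> g \<oplus> z" using split[OF j] by blast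
      have zc: "z \<in> carrier R" "j \<in> carrier R" using rz j by auto
      have "?t \<otimes> s \<otimes> j = ?t \<otimes> (r \<otimes> g \<oplus> z)"
        using t s(1) zc by (simp add: m_assoc rz(3))
      also have "\<dots> = r \<otimes> (?t \<otimes> g) \<oplus> ?t \<otimes> z"
        using t rz(1) g(1) zc by (simp add: r_distr m_lcomm del: minus_closed)
      also have "\<dots> \<in> Idl B"
        unfolding \<open>?t \<otimes> g = y\<close> by (intro B.a_closed B.I_l_closed p(2) rz(1,2) t)
      finally show ?thesis .
    qed
    moreover have "\<one> \<ominus> ?t \<otimes> s \<in> P"
    proof -
      have "(\<one> \<ominus> s) \<oplus> ((\<one> \<ominus> s) \<otimes> s \<oplus> p \<otimes> s) \<in> P"
        by (intro P.a_closed P.I_r_closed s p(1))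
      also have "(\<one> \<ominus> s) \<oplus> ((\<one> \<ominus> s) \<otimes> s \<oplus> p \<otimes> s) = \<one> \<ominus> ?t \<otimes> s"
        using s(1) pc(1) by (simp add: minus_eq l_distr l_minus minus_add a_assoc r_neg1)
      finally show ?thesis .
    qed
    ultimately show ?case
      using insert.IH[of "?t \<otimes> s"] insert.prems(1) t s(1) by blast
  qed
  have "A \<subseteq> J" using genideal_self[OF A(3)] A(2) by simp
  then show ?thesis
    using step[OF A(1), of \<one>] A(2) P.zero_closed J.a_subset by (auto simp: minus_eq r_neg)
qed

lemma (in noetherian_domain) ideal_eq_prod_imp_zero:
  assumes "ideal P R" "P \<noteq> carrier R" "ideal J R" "J \<subseteq> P \<cdot> J"
  shows "J = {\<zero>}"
proof -
  interpret P: ideal P R by fact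
  interpret J: ideal J R by fact
  obtain A where "A \<subseteq> carrier R" "finite A" "J = Idl A" using finetely_gen[OF assms(3)] by blast
  then obtain s where s: "s \<in> carrier R" "\<one> \<ominus> s \<in> P" "\<And>j. j \<in> J \<Longrightarrow> s \<otimes> j = \<zero>"
    using Nakayama[OF assms(1,3,4)] by blast
  have "s \<noteq> \<zero>" using s(2) P.one_imp_carrier assms(2) by (auto simp: minus_eq)
  then show ?thesis using s J.zero_closed J.Icarr integral_iff by blast
qed

section \<open>Quotients by products of primes\<close>

text \<open>The quotient is von Neumann regular. For a single maximal ideal, \<open>a \<otimes> (\<one> \<ominus> a \<otimes> x)\<close> can be put into
  it, with \<open>a \<otimes> x\<close> congruent to \<open>\<zero>\<close> or \<open>\<one>\<close>. Several ideals are handled at once by multiplying the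
  factors \<open>\<one> \<ominus> a \<otimes> x\<close>, since the product is again of this form.\<close>

lemma PF_quotient_by_intersection_of_maximal_ideals:
  fixes R (structure)
  assumes "cring R" "finite A" "\<And>i. i \<in> A \<Longrightarrow> maximalideal (Q i) R" "ideal I R"
    and I: "I = {x \<in> carrier R. \<forall>i\<in>A. x \<in> Q i}"
  shows "PF_ring (R Quot I)"
proof -
  interpret cring R by fact
  interpret ideal I R by fact
  interpret h: ring_hom_ring R "R Quot I" "(+>) I" by (rule rcos_ring_hom_ring)
  have "\<exists>x\<in>carrier R. \<forall>i\<in>A. a \<ominus> a \<otimes> a \<otimes> x \<in> Q i" if a: "a \<in> carrier R" for a
    using assms(2,3)
  proof (induction A rule: finite_induct)
    case empty
    show ?case by blast
  next
    case (insert i A)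
    then obtain x where x: "x \<in> carrier R" "\<And>j. j \<in> A \<Longrightarrow> a \<ominus> a \<otimes> a \<otimes> x \<in> Q j" by auto
    interpret M: maximalideal "Q i" R using insert.prems by simp
    interpret F: field "R Quot Q i" by (rule M.quotient_is_field[OF is_cring])
    interpret g: ring_hom_ring R "R Quot Q i" "(+>) (Q i)" by (rule M.rcos_ring_hom_ring)
    obtain y where y: "y \<in> carrier R" "a \<ominus> a \<otimes> a \<otimes> y \<in> Q i"
    proof (cases "a \<in> Q i")
      case True
      then show ?thesis using a by (intro that[of \<zero>]) (auto simp: minus_eq)
    next
      case False
      then have "Q i +> a \<in> Units (R Quot Q i)"
        using a M.quotient_eq_zero_iff[of a] by (simp add: F.field_Units)
      then obtain y where y: "y \<in> carrier R"
        "(Q i +> a) \<otimes>\<^bsub>R Quot Q i\<^esub> (Q i +> y) = \<one>\<^bsub>R Quot Q i\<^esub>"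
        using F.Units_r_inv_ex[of "Q i +> a"] unfolding M.carrier_quotient by blast
      have "Q i +> (a \<ominus> a \<otimes> a \<otimes> y) = \<zero>\<^bsub>R Quot Q i\<^esub>"
        using a y by (simp add: minus_eq F.m_assoc F.r_neg)
      then show ?thesis using that y(1) a by (simp add: M.quotient_eq_zero_iff)
    qed
    \<comment> \<open>Chosen so that \<open>\<one> \<ominus> a \<otimes> ?z = (\<one> \<ominus> a \<otimes> x) \<otimes> (\<one> \<ominus> a \<otimes> y)\<close>.\<close>
    let ?z = "x \<oplus> (y \<ominus> a \<otimes> x \<otimes> y)"
    have z1: "a \<ominus> a \<otimes> a \<otimes> ?z = (a \<ominus> a \<otimes> a \<otimes> x) \<otimes> (\<one> \<ominus> a \<otimes> y)"
      and z2: "a \<ominus> a \<otimes> a \<otimes> ?z = (a \<ominus> a \<otimes> a \<otimes> y) \<otimes> (\<one> \<ominus> a \<otimes> x)"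
      using a x(1) y(1) by algebra+
    have "a \<ominus> a \<otimes> a \<otimes> ?z \<in> Q j" if "j \<in> insert i A" for j
    proof (cases "j = i")
      case True
      then show ?thesis unfolding z2 using y a x(1) by (simp add: M.I_r_closed)
    next
      case False
      then have "ideal (Q j) R" "j \<in> A" using insert.prems that maximalideal.axioms(1) by auto
      then show ?thesis unfolding z1 using x y(1) a by (simp add: ideal.I_r_closed)
    qed
    then show ?case using a x(1) y(1) by (intro bexI[of _ ?z]) auto
  qed
  then have reg: "\<exists>x\<in>carrier R. a \<ominus> a \<otimes> a \<otimes> x \<in> I" if "a \<in> carrier R" for a
    using that unfolding I by fastforce
  show ?thesis
  proof (rule von_Neumann_regular_imp_PF_ring[OF quotient_is_cring[OF is_cring]])
    fix U assume "U \<in> carrier (R Quot I)"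
    then obtain a where a: "a \<in> carrier R" "U = I +> a" by (auto simp: carrier_quotient)
    obtain x where x: "x \<in> carrier R" "a \<ominus> a \<otimes> a \<otimes> x \<in> I" using reg[OF a(1)] by blast
    then have "I +> a = I +> (a \<otimes> a \<otimes> x)"
      using a quotient_eq_iff_same_a_r_cos[OF is_ideal, of a "a \<otimes> a \<otimes> x"] by simp
    then show "\<exists>V\<in>carrier (R Quot I). U \<otimes>\<^bsub>R Quot I\<^esub> U \<otimes>\<^bsub>R Quot I\<^esub> V = U"
      using a x(1) by (intro bexI[of _ "I +> x"]) simp_all
  qed
qed

text \<open>With \<open>J = P \<cdot> K\<close>, the square of an element of \<open>J\<close> lies in \<open>P \<cdot> J = I\<close>. As \<open>R / I\<close> is reduced, \<open>J\<close>
  is contained in \<open>P \<cdot> J\<close>. Nakayama's lemma makes \<open>J\<close>, and with it \<open>I\<close>, zero.\<close>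

lemma (in noetherian_domain) PF_quotient_imp_squarefree:
  assumes "PF_ring (R Quot I)" and nz: "I \<noteq> {\<zero>}" and "ideal P R" "P \<noteq> carrier R" "ideal K R"
  shows "I \<noteq> P \<cdot> (P \<cdot> K)"
proof
  assume I: "I = P \<cdot> (P \<cdot> K)"
  let ?J = "P \<cdot> K"
  have J: "ideal ?J R" and id: "ideal I R" using assms ideal_prod_is_ideal I by auto
  have "?J \<subseteq> I"
  proof
    fix j assume j: "j \<in> ?J"
    then have "j \<in> P" using ideal_prod_inter[OF assms(3,5)] by blast
    then have "j \<otimes> j \<in> I" unfolding I using j by (rule ideal_prod.prod)
    then show "j \<in> I" using PF_quotient_imp_radical[OF id assms(1)] ideal.Icarr[OF J j] by blast
  qed
  then have "?J = {\<zero>}" using ideal_eq_prod_imp_zero[OF assms(3,4) J] I by blast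
  then show False using nz I ideal_prod_zero[OF assms(3)] by simp
qed

theorem theorem2p7:
  fixes R :: "('a, 'r) ring_scheme" (structure) and I :: "'a set"
  assumes "cring R" and "ideal I R"
  shows
    "(\<forall>(n :: nat) (P :: nat \<Rightarrow> 'a set) (\<alpha> :: nat \<Rightarrow> nat).
        Dedekind_domain R \<longrightarrow> I \<noteq> {\<zero>} \<longrightarrow>
        (\<forall>i \<in> {1..n}. primeideal (P i) R \<and> \<alpha> i > 0) \<longrightarrow> inj_on P {1..n} \<longrightarrow>
        I = finprod (ideals_set R) (\<lambda>i. P i [^]\<^bsub>ideals_set R\<^esub> \<alpha> i) {1..n} \<longrightarrow>
        (PF_ring (R Quot I) \<longleftrightarrow> (\<forall>i \<in> {1..n}. \<alpha> i = 1)))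
     \<and> (primary_ideal I R \<and> PF_ring (R Quot I) \<longleftrightarrow> primeideal I R)"
proof (intro conjI allI impI)
  interpret cring R by fact
  interpret I: ideal I R by fact
  interpret S: comm_monoid "ideals_set R" by (rule ideals_set_is_comm_monoid)
  fix n :: nat and P :: "nat \<Rightarrow> 'a set" and \<alpha> :: "nat \<Rightarrow> nat"
  let ?Q = "\<lambda>i. P i [^]\<^bsub>ideals_set R\<^esub> \<alpha> i"
  assume "Dedekind_domain R" and nz: "I \<noteq> {\<zero>}"
    and prime: "\<forall>i \<in> {1..n}. primeideal (P i) R \<and> \<alpha> i > 0" and inj: "inj_on P {1..n}"
    and I: "I = finprod (ideals_set R) ?Q {1..n}"
  then interpret noetherian_domain R by (simp add: Dedekind_domain_def)
  have id: "ideal (P i) R" if "i \<in> {1..n}" for i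
    using prime that primeideal.axioms(1) by blast
  have Q: "?Q \<in> {1..n} \<rightarrow> {J. ideal J R}"
    using S.nat_pow_closed id by auto
  show "PF_ring (R Quot I) \<longleftrightarrow> (\<forall>i \<in> {1..n}. \<alpha> i = 1)"
  proof
    assume PF: "PF_ring (R Quot I)"
    show "\<forall>i \<in> {1..n}. \<alpha> i = 1"
    proof (rule ballI, rule ccontr)
      fix i assume i: "i \<in> {1..n}" and "\<alpha> i \<noteq> 1"
      then have "\<alpha> i = Suc (Suc (\<alpha> i - 2))" using prime by fastforce
      then obtain k where k: "\<alpha> i = Suc (Suc k)" by blast
      let ?X = "P i [^]\<^bsub>ideals_set R\<^esub> k" and ?Y = "finprod (ideals_set R) ?Q ({1..n} - {i})"
      have X: "ideal ?X R" and Y: "ideal ?Y R"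
        using S.nat_pow_closed[of "P i" k] id[OF i] finprod_ideals_ideal[of ?Q "{1..n} - {i}"] Q by auto
      have Pi: "P i \<in> carrier (ideals_set R)" and Xc: "?X \<in> carrier (ideals_set R)"
        and Yc: "?Y \<in> carrier (ideals_set R)" using id[OF i] X Y by auto
      have "I = ?Q i \<otimes>\<^bsub>ideals_set R\<^esub> ?Y"
        using finprod_ideals_factor[OF _ i Q] I by simp
      also have "\<dots> = P i \<otimes>\<^bsub>ideals_set R\<^esub> (P i \<otimes>\<^bsub>ideals_set R\<^esub> (?X \<otimes>\<^bsub>ideals_set R\<^esub> ?Y))"
        unfolding k S.nat_pow_Suc using Pi Xc Yc by (simp only: S.m_ac S.m_closed)
      also have "\<dots> = P i \<cdot> (P i \<cdot> (?X \<cdot> ?Y))" by simp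
      finally show False
        using PF_quotient_imp_squarefree[OF PF nz id[OF i] _ ideal_prod_is_ideal[OF X Y]]
          primeideal.I_notcarr prime i by metis
    qed
  next
    assume one: "\<forall>i \<in> {1..n}. \<alpha> i = 1"
    have IP: "I = finprod (ideals_set R) P {1..n}"
      unfolding I by (rule S.finprod_cong') (use one id S.nat_pow_eone in auto)
    have PI: "P \<in> {1..n} \<rightarrow> {J. ideal J R}" using id by auto
    have max: "maximalideal (P i) R" if i: "i \<in> {1..n}" for i
    proof -
      have "I \<subseteq> P i" unfolding IP by (rule finprod_ideals_subset[OF _ i PI]) simp
      then have "P i \<noteq> {\<zero>}" using nz I.zero_closed by blast
      then show ?thesis using \<open>Dedekind_domain R\<close> prime i by (simp add: Dedekind_domain_def)
    qed
    show "PF_ring (R Quot I)"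
    proof (rule PF_quotient_by_intersection_of_maximal_ideals[OF is_cring _ max assms(2)])
      show "I = {x \<in> carrier R. \<forall>i\<in>{1..n}. x \<in> P i}"
        unfolding IP by (rule finprod_distinct_maximal_ideals[OF _ max inj]) simp_all
    qed simp_all
  qed
next
  show "primary_ideal I R \<and> PF_ring (R Quot I) \<longleftrightarrow> primeideal I R"
    using primary_PF_quotient_imp_prime[OF assms(1)] primeideal.primeideal_imp_primary_ideal
      domain_imp_PF_ring primeideal.quotient_is_domain by blast
qed

end
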